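(* Let $\Omega\subset\mathbb R^3$ be a domain, let $\boldsymbol F\in\mathcal M^{2,\lambda}_{\rm loc}(\Omega)$ for some $1<\lambda<3$, and let $\boldsymbol B\in W^{1,2}_{\rm loc}(\Omega)$ be a suitable weak solution to $$-\Delta\boldsymbol B=-\nabla\times((\nabla\times\boldsymbol B)\times\boldsymbol B)+\nabla\times\boldsymbol F\quad\text{in }\Omega.$$ Then the singular set $\Sigma(\boldsymbol B)$ satisfies $$\mathcal H^\beta(\Sigma(\boldsymbol B))=0\qquad\forall\,\beta>1,$$ where $\mathcal H^\beta$ is the $\beta$-dimensional Hausdorff measure; consequently $\Sigma(\boldsymbol B)$ has Hausdorff dimension at most one.
   Context: All functions denoted in bold are $\mathbb R^3$-valued. $B_r(x_0)$ is the ball of radius $r$ centred at $x_0$, and $\boldsymbol B_{r,x_0}=\frac{1}{|B_r(x_0)|}\int_{B_r(x_0)}\boldsymbol B\,dx$. Morrey space: $\boldsymbol F\in\mathcal M^{2,\lambda}_{\rm loc}(\Omega)$ means that for every $K\subset\subset\Omega$, $\sup\{r^{-\lambda}\int_{B_r(x_0)}|\boldsymbol F|^2dx : x_0\in K,\ 0<r\le\operatorname{dist}(K,\partial\Omega)\}<+\infty$ (radii finite; $\operatorname{dist}(K,\partial\Omega)=+\infty$ if $\Omega=\mathbb R^3$). For $\boldsymbol F\in L^2_{\rm loc}(\Omega)$, $\boldsymbol B\in W^{1,2}_{\rm loc}(\Omega)$ is a weak solution of the equation if for all $\boldsymbol\varphi\in C^\infty_{\rm c}(\Omega)$ $$\int_\Omega\nabla\boldsymbol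 B:\nabla\boldsymbol\varphi\,dx=-\int_\Omega((\nabla\times\boldsymbol B)\times\boldsymbol B)\cdot(\nabla\times\boldsymbol\varphi)\,dx+\int_\Omega\boldsymbol F\cdot(\nabla\times\boldsymbol\varphi)\,dx.$$ It is a suitable weak solution if in addition, for all non-negative $\phi\in C^\infty_{\rm c}(\Omega)$, $$\int_\Omega\phi|\nabla\boldsymbol B|^2dx\le\frac12\int_\Omega\Delta\phi\,|\boldsymbol B|^2dx-\int_\Omega((\nabla\times\boldsymbol B)\times\boldsymbol B)\cdot(\nabla\phi\times\boldsymbol B)\,dx+\int_\Omega\big(\phi\,\boldsymbol F\cdot(\nabla\times\boldsymbol B)+\boldsymbol F\cdot(\nabla\phi\times\boldsymbol B)\big)dx.$$ Singular set: $\Sigma(\boldsymbol B)$ is the set of $x_0\in\Omega$ such that $$\liminf_{r\to0^+}\frac1r\int_{B_r(x_0)}|\nabla\boldsymbol B|^2dx>0\quad\text{or}\quad\sup_{0<r<r_0}|\boldsymbol B_{r,x_0}|=+\infty\ \text{ for some (equivalently every) } 0<r_0<\operatorname{dist}(x_0,\partial\Omega).$$ *)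

theory Defs
  imports "HOL-Analysis.Analysis"
begin

definition partial_deriv :: "'n::finite \<Rightarrow> (real^'n \<Rightarrow> 'b::real_normed_vector) \<Rightarrow> real^'n \<Rightarrow> 'b"
  where "partial_deriv j f x = frechet_derivative f (at x) (axis j 1)"

primrec Ck :: "nat \<Rightarrow> (real^'n \<Rightarrow> 'b::real_normed_vector) \<Rightarrow> bool" where
  "Ck 0 f \<longleftrightarrow> continuous_on UNIV f"
| "Ck (Suc k) f \<longleftrightarrow> (\<forall>x. f differentiable (at x)) \<and> (\<forall>j. Ck k (partial_deriv j f))"

text \<open>\<open>C\<^sup>\<infinity>\<^sub>c(\<Omega>)\<close>; test functions are extended by zero to the whole space.\<close>

definition test_function :: "(real^'n) set \<Rightarrow> (real^'n \<Rightarrow> 'b::real_normed_vector) \<Rightarrow> bool"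
  where "test_function \<Omega> f \<longleftrightarrow>
    (\<forall>k. Ck k f) \<and> compact (closure {x. f x \<noteq> 0}) \<and> closure {x. f x \<noteq> 0} \<subseteq> \<Omega>"

definition grad :: "(real^'n \<Rightarrow> real) \<Rightarrow> real^'n \<Rightarrow> real^'n"
  where "grad \<phi> x = (\<chi> j. partial_deriv j \<phi> x)"

definition laplacian :: "(real^'n \<Rightarrow> real) \<Rightarrow> real^'n \<Rightarrow> real"
  where "laplacian \<phi> x = (\<Sum>j\<in>UNIV. partial_deriv j (partial_deriv j \<phi>) x)"

text \<open>Gradients of vector fields are matrices with entries \<open>G $ i $ j = \<partial>\<^sub>j B\<^sub>i\<close>, as for the library
  constant \<^const>\<open>jacobian\<close>. The inner product and norm of \<^typ>\<open>real^3^3\<close> are the Frobenius ones.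
  The curl is a function of this matrix, so that it applies to weak and classical gradients alike.\<close>

definition curl_of :: "real^3^3 \<Rightarrow> real^3"
  where "curl_of G = vector [G$3$2 - G$2$3, G$1$3 - G$3$1, G$2$1 - G$1$2]"

definition curl :: "(real^3 \<Rightarrow> real^3) \<Rightarrow> real^3 \<Rightarrow> real^3"
  where "curl \<phi> x = curl_of (jacobian \<phi> (at x))"

definition L2_loc :: "(real^3) set \<Rightarrow> (real^3 \<Rightarrow> 'b::euclidean_space) \<Rightarrow> bool"
  where "L2_loc \<Omega> f \<longleftrightarrow> set_borel_measurable lebesgue \<Omega> f \<and>
    (\<forall>K. compact K \<and> K \<subseteq> \<Omega> \<longrightarrow> set_integrable lebesgue K (\<lambda>x. (norm (f x))\<^sup>2))"

definition has_weak_gradient ::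
  "(real^3) set \<Rightarrow> (real^3 \<Rightarrow> real^3) \<Rightarrow> (real^3 \<Rightarrow> real^3^3) \<Rightarrow> bool"
  where "has_weak_gradient \<Omega> B G \<longleftrightarrow> (\<forall>\<phi>. test_function \<Omega> \<phi> \<longrightarrow> (\<forall>i j.
    (LINT x:\<Omega>|lebesgue. B x $ i * partial_deriv j \<phi> x) = - (LINT x:\<Omega>|lebesgue. G x $ i $ j * \<phi> x)))"

definition W12_loc :: "(real^3) set \<Rightarrow> (real^3 \<Rightarrow> real^3) \<Rightarrow> bool"
  where "W12_loc \<Omega> B \<longleftrightarrow> L2_loc \<Omega> B \<and> (\<exists>G. L2_loc \<Omega> G \<and> has_weak_gradient \<Omega> B G)"

text \<open>A representative of the weak gradient, which for \<^term>\<open>W12_loc \<Omega> B\<close> is unique almost everywhere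
  in \<open>\<Omega>\<close>.\<close>

definition weak_gradient :: "(real^3) set \<Rightarrow> (real^3 \<Rightarrow> real^3) \<Rightarrow> real^3 \<Rightarrow> real^3^3"
  where "weak_gradient \<Omega> B = (SOME G. L2_loc \<Omega> G \<and> has_weak_gradient \<Omega> B G)"

definition weak_curl :: "(real^3) set \<Rightarrow> (real^3 \<Rightarrow> real^3) \<Rightarrow> real^3 \<Rightarrow> real^3"
  where "weak_curl \<Omega> B x = curl_of (weak_gradient \<Omega> B x)"

text \<open>Unlike \<^const>\<open>setdist\<close>, this distance is \<open>\<infinity>\<close> if one of the sets is empty.\<close>

definition esetdist :: "'a::metric_space set \<Rightarrow> 'a set \<Rightarrow> ereal"
  where "esetdist A B = (INF x\<in>A. INF y\<in>B. ereal (dist x y))"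

text \<open>The integral is the nonnegative one because balls of the extremal radius may touch
  \<open>\<partial>\<Omega>\<close>, where a locally square integrable function could have infinite integral.\<close>

definition Morrey2_loc :: "real \<Rightarrow> (real^3) set \<Rightarrow> (real^3 \<Rightarrow> real^3) \<Rightarrow> bool"
  where "Morrey2_loc lam \<Omega> F \<longleftrightarrow> set_borel_measurable lebesgue \<Omega> F \<and>
    (\<forall>K. compact (closure K) \<and> closure K \<subseteq> \<Omega> \<longrightarrow>
      (SUP (x0, r) \<in> {(x0, r). x0 \<in> K \<and> 0 < r \<and> ereal r \<le> esetdist K (frontier \<Omega>)}.
        ennreal (r powr (- lam)) * (\<integral>\<^sup>+x\<in>ball x0 r. ennreal ((norm (F x))\<^sup>2) \<partial>lebesgue)) < \<infinity>)"

context includes cross3_syntax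
begin

definition weak_solution ::
  "(real^3) set \<Rightarrow> (real^3 \<Rightarrow> real^3) \<Rightarrow> (real^3 \<Rightarrow> real^3) \<Rightarrow> bool"
  where "weak_solution \<Omega> F B \<longleftrightarrow> L2_loc \<Omega> F \<and> W12_loc \<Omega> B \<and>
    (\<forall>\<phi>::real^3 \<Rightarrow> real^3. test_function \<Omega> \<phi> \<longrightarrow>
      (LINT x:\<Omega>|lebesgue. weak_gradient \<Omega> B x \<bullet> jacobian \<phi> (at x)) =
        - (LINT x:\<Omega>|lebesgue. ((weak_curl \<Omega> B x) \<times> (B x)) \<bullet> curl \<phi> x)
        + (LINT x:\<Omega>|lebesgue. F x \<bullet> curl \<phi> x))"

definition suitable_weak_solution ::
  "(real^3) set \<Rightarrow> (real^3 \<Rightarrow> real^3) \<Rightarrow> (real^3 \<Rightarrow> real^3) \<Rightarrow> bool"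
  where "suitable_weak_solution \<Omega> F B \<longleftrightarrow> weak_solution \<Omega> F B \<and>
    (\<forall>\<phi>::real^3 \<Rightarrow> real. test_function \<Omega> \<phi> \<and> (\<forall>x. 0 \<le> \<phi> x) \<longrightarrow>
      (LINT x:\<Omega>|lebesgue. \<phi> x * (norm (weak_gradient \<Omega> B x))\<^sup>2) \<le>
        1/2 * (LINT x:\<Omega>|lebesgue. laplacian \<phi> x * (norm (B x))\<^sup>2)
        - (LINT x:\<Omega>|lebesgue. ((weak_curl \<Omega> B x) \<times> (B x)) \<bullet> ((grad \<phi> x) \<times> (B x)))
        + (LINT x:\<Omega>|lebesgue. \<phi> x * (F x \<bullet> weak_curl \<Omega> B x) + F x \<bullet> ((grad \<phi> x) \<times> (B x))))"

end

definition ball_average :: "(real^3 \<Rightarrow> real^3) \<Rightarrow> real^3 \<Rightarrow> real \<Rightarrow> real^3"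
  where "ball_average B x0 r = (1 / measure lebesgue (ball x0 r)) *\<^sub>R (LINT x:ball x0 r|lebesgue. B x)"

definition singular_set :: "(real^3) set \<Rightarrow> (real^3 \<Rightarrow> real^3) \<Rightarrow> (real^3) set"
  where "singular_set \<Omega> B = {x0 \<in> \<Omega>.
    Liminf (at_right 0)
      (\<lambda>r. ereal (1 / r * (LINT x:ball x0 r|lebesgue. (norm (weak_gradient \<Omega> B x))\<^sup>2))) > 0 \<or>
    (\<exists>r0. 0 < r0 \<and> ereal r0 < esetdist {x0} (frontier \<Omega>) \<and>
      (SUP r\<in>{0<..<r0}. ereal (norm (ball_average B x0 r))) = \<infinity>)}"

text \<open>Hausdorff (outer) measure, with the usual normalisation \<open>\<omega>\<^sub>\<beta> (diam U / 2)\<^sup>\<beta>\<close> and the conventions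
  \<open>0\<^sup>0 = 1\<close> and that the empty set contributes \<open>0\<close>. Covering sets are required to be bounded since
  \<^const>\<open>diameter\<close> is meaningless for unbounded sets.\<close>

definition hausdorff_weight :: "real \<Rightarrow> 'a::metric_space set \<Rightarrow> real"
  where "hausdorff_weight \<beta> U = (if U = {} then 0
    else unit_ball_vol \<beta> * (if \<beta> = 0 then 1 else (diameter U / 2) powr \<beta>))"

definition hausdorff_content :: "real \<Rightarrow> real \<Rightarrow> 'a::metric_space set \<Rightarrow> ennreal"
  where "hausdorff_content \<beta> \<delta> A =
    (INF U\<in>{U :: nat \<Rightarrow> 'a set. A \<subseteq> (\<Union>i. U i) \<and> (\<forall>i. bounded (U i) \<and> diameter (U i) \<le> \<delta>)}.
      \<Sum>i. ennreal (hausdorff_weight \<beta> (U i)))"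

definition hausdorff_measure :: "real \<Rightarrow> 'a::metric_space set \<Rightarrow> ennreal"
  where "hausdorff_measure \<beta> A = (SUP \<delta>\<in>{0<..}. hausdorff_content \<beta> \<delta> A)"

definition hausdorff_dim :: "'a::metric_space set \<Rightarrow> ereal"
  where "hausdorff_dim A = (INF \<beta>\<in>{\<beta>. 0 \<le> \<beta> \<and> hausdorff_measure \<beta> A = 0}. ereal \<beta>)"

end

theory Submission
  imports Defs
begin

text \<open>Write \<open>G\<close> for the weak gradient of \<open>B\<close>, which is locally square integrable, fix \<open>\<beta> > 1\<close>, and call
a point \<open>a\<close> of \<open>\<Omega>\<close> good if \<open>\<integral>\<^bsub>ball a r\<^esub> |G|\<^sup>2 \<le> c r\<^sup>\<beta>\<close> for some constant \<open>c\<close> and all small \<open>r\<close>. The proof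
compares the singular set with the set of points that are not good.

A point that is not good is the centre of arbitrarily small balls with
\<open>r\<^sup>\<beta> \<le> c\<^sup>-\<^sup>1 \<integral>\<^bsub>ball a r\<^esub> |G|\<^sup>2\<close>, for \<open>c\<close> as large as one likes. By Vitali's covering lemma disjoint balls of
this kind can be chosen, inside a compact part of \<open>\<Omega>\<close>, whose fivefold enlargements cover all such
points of a smaller compact part. The sum of their \<open>r\<^sup>\<beta>\<close> is at most \<open>c\<^sup>-\<^sup>1 \<integral> |G|\<^sup>2\<close>; letting \<open>c\<close> tend to infinity, the \<open>\<beta>\<close>-dimensional measure is zero
(\<open>hausdorff_null_of_large_density\<close>).

A good point is regular (\<open>regular_of_gradient_growth\<close>). The rescaled energy is at most
\<open>c r\<^sup>\<beta>\<^sup>-\<^sup>1\<close> and tends to zero. For the averages, let \<open>\<eta>\<close> be a smooth function of \<open>|y|\<close> supported in the unit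
ball, and put \<open>m(r) = r\<^sup>-\<^sup>3 \<integral> B(x) \<eta>((x - a)/r) dx\<close>. Differentiating the kernel in \<open>r\<close> gives
\<open>- r\<^sup>-\<^sup>4\<close> times the divergence of the test field \<open>(x - a) \<eta>((x - a)/r)\<close>, so the definition of the weak gradient
yields \<open>m'(r) = r\<^sup>-\<^sup>4 \<integral> G (x - a) \<eta>((x - a)/r) dx\<close>
(\<open>cutoff_average_derivative\<close>). If \<open>0 \<le> \<eta> \<le> 1\<close> then \<open>|m'(r)| \<le> r\<^sup>-\<^sup>3 \<integral>\<^bsub>ball a r\<^esub> |G| \<le> C r\<^bsup>(\<beta> - 3)/2\<^esup>\<close>, which is
integrable at zero exactly because \<open>\<beta> > 1\<close>. The bound does not depend on \<open>\<eta>\<close>, so it survives when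
\<open>\<eta>\<close> increases to the indicator of the ball (\<open>ball_integral_oscillation\<close>), and the averages of \<open>B\<close> over
balls around \<open>a\<close> stay bounded.

Hence the singular set contains no good point and is a null set for every \<open>\<beta> > 1\<close>.\<close>

section \<open>Null sets of Hausdorff measures\<close>

lemma hausdorff_measure_eq_0_iff:
  "hausdorff_measure \<beta> A = 0 \<longleftrightarrow>
    (\<forall>\<delta>>0. \<forall>e>0. \<exists>U::nat \<Rightarrow> 'a::metric_space set. A \<subseteq> (\<Union>i. U i) \<and>
       (\<forall>i. bounded (U i) \<and> diameter (U i) \<le> \<delta>) \<and>
       (\<Sum>i. ennreal (hausdorff_weight \<beta> (U i))) \<le> ennreal e)"
  (is "_ \<longleftrightarrow> (\<forall>\<delta>>0. \<forall>e>0. ?C \<delta> e)")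
proof -
  have content: "hausdorff_content \<beta> \<delta> A = 0 \<longleftrightarrow> (\<forall>e>0. ?C \<delta> e)" for \<delta>
  proof
    assume 0: "hausdorff_content \<beta> \<delta> A = 0"
    show "\<forall>e>0. ?C \<delta> e"
    proof (intro allI impI)
      fix e :: real assume "e > 0"
      then have "hausdorff_content \<beta> \<delta> A < ennreal e" using 0 by simp
      then obtain U where "U \<in> {U :: nat \<Rightarrow> 'a set. A \<subseteq> (\<Union>i. U i) \<and>
            (\<forall>i. bounded (U i) \<and> diameter (U i) \<le> \<delta>)}"
          "(\<Sum>i. ennreal (hausdorff_weight \<beta> (U i))) < ennreal e"
        unfolding hausdorff_content_def INF_less_iff by (elim bexE)
      then show "?C \<delta> e" by (intro exI[of _ U]) (simp add: less_imp_le)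
    qed
  next
    assume small: "\<forall>e>0. ?C \<delta> e"
    have "hausdorff_content \<beta> \<delta> A \<le> 0 + ennreal e" if e: "e > 0" for e
    proof -
      obtain U where U: "A \<subseteq> (\<Union>i. U i)" "\<forall>i. bounded (U i) \<and> diameter (U i) \<le> \<delta>"
        "(\<Sum>i. ennreal (hausdorff_weight \<beta> (U i))) \<le> ennreal e"
        using small e by blast
      have "hausdorff_content \<beta> \<delta> A \<le> (\<Sum>i. ennreal (hausdorff_weight \<beta> (U i)))"
        unfolding hausdorff_content_def by (rule INF_lower) (use U in auto)
      with U(3) show ?thesis by simp
    qed
    then have "hausdorff_content \<beta> \<delta> A \<le> 0" by (rule ennreal_le_epsilon)
    then show "hausdorff_content \<beta> \<delta> A = 0" by simp
  qed
  have "hausdorff_measure \<beta> A = 0 \<longleftrightarrow> (\<forall>\<delta>>0. hausdorff_content \<beta> \<delta> A = 0)"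
    using SUP_bot_conv(1)[of "\<lambda>\<delta>. hausdorff_content \<beta> \<delta> A" "{0<..}"]
    by (simp add: hausdorff_measure_def bot_ennreal Ball_def)
  then show ?thesis by (simp only: content)
qed

lemma hausdorff_measure_null_mono:
  fixes A B :: "'a::metric_space set"
  assumes "hausdorff_measure \<beta> B = 0" and "A \<subseteq> B"
  shows "hausdorff_measure \<beta> A = 0"
  unfolding hausdorff_measure_eq_0_iff
proof (intro allI impI)
  fix \<delta> e :: real assume "\<delta> > 0" "e > 0"
  then obtain U :: "nat \<Rightarrow> 'a set" where U: "B \<subseteq> (\<Union>i. U i)"
      "\<forall>i. bounded (U i) \<and> diameter (U i) \<le> \<delta>"
      "(\<Sum>i. ennreal (hausdorff_weight \<beta> (U i))) \<le> ennreal e"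
    using assms(1)[unfolded hausdorff_measure_eq_0_iff] by blast
  then show "\<exists>U::nat \<Rightarrow> 'a set. A \<subseteq> (\<Union>i. U i) \<and>
       (\<forall>i. bounded (U i) \<and> diameter (U i) \<le> \<delta>) \<and>
       (\<Sum>i. ennreal (hausdorff_weight \<beta> (U i))) \<le> ennreal e"
    using assms(2) by (intro exI[of _ U]) (simp add: order_trans[OF assms(2)])
qed

lemma hausdorff_measure_null_UN:
  fixes A :: "nat \<Rightarrow> 'a::metric_space set"
  assumes "\<And>n. hausdorff_measure \<beta> (A n) = 0"
  shows "hausdorff_measure \<beta> (\<Union>n. A n) = 0"
  unfolding hausdorff_measure_eq_0_iff
proof (intro allI impI)
  fix \<delta> e :: real assume "\<delta> > 0" "e > 0"
  let ?P = "\<lambda>n U. A n \<subseteq> (\<Union>i::nat. U i) \<and> (\<forall>i. bounded (U i) \<and> diameter (U i) \<le> \<delta>) \<and>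
       (\<Sum>i. ennreal (hausdorff_weight \<beta> (U i))) \<le> ennreal (e * (1/2) ^ Suc n)"
  have "\<exists>U. ?P n U" for n
    by (rule assms[of n, unfolded hausdorff_measure_eq_0_iff, rule_format])
      (use \<open>\<delta> > 0\<close> \<open>e > 0\<close> in auto)
  then have "\<exists>U. \<forall>n. ?P n (U n)" by (intro choice allI)
  then obtain U where "\<forall>n. ?P n (U n)" by (elim exE)
  then have U: "\<And>n. A n \<subseteq> (\<Union>i. U n i)"
      "\<And>n i. bounded (U n i) \<and> diameter (U n i) \<le> \<delta>"
      "\<And>n. (\<Sum>i. ennreal (hausdorff_weight \<beta> (U n i))) \<le> ennreal (e * (1/2) ^ Suc n)"
    by blast+
  let ?V = "\<lambda>k. case prod_decode k of (n, i) \<Rightarrow> U n i"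
  have "(\<Sum>k. ennreal (hausdorff_weight \<beta> (?V k)))
      = (\<Sum>n. \<Sum>i. ennreal (hausdorff_weight \<beta> (U n i)))"
    using suminf_ennreal_2dimen[of "\<lambda>n. \<Sum>i. ennreal (hausdorff_weight \<beta> (U n i))"
        "\<lambda>(n, i). ennreal (hausdorff_weight \<beta> (U n i))"]
    by (simp add: case_prod_unfold)
  also have "\<dots> \<le> (\<Sum>n. ennreal (e * (1/2) ^ Suc n))"
    by (intro suminf_le U(3)) auto
  also have "\<dots> = ennreal e"
    using sums_mult[OF power_half_series, of e] \<open>e > 0\<close>
    by (subst suminf_ennreal_eq) auto
  finally have "(\<Sum>k. ennreal (hausdorff_weight \<beta> (?V k))) \<le> ennreal e" .
  moreover have "(\<Union>n. A n) \<subseteq> (\<Union>k. ?V k)"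
  proof
    fix x assume "x \<in> (\<Union>n. A n)"
    then obtain n i where "x \<in> U n i" using U(1) by blast
    then have "x \<in> ?V (prod_encode (n, i))" by simp
    then show "x \<in> (\<Union>k. ?V k)" by (rule UN_I[OF UNIV_I])
  qed
  moreover have "\<forall>k. bounded (?V k) \<and> diameter (?V k) \<le> \<delta>"
    using U(2) by (auto simp: case_prod_unfold)
  ultimately show "\<exists>V::nat \<Rightarrow> 'a set. (\<Union>n. A n) \<subseteq> (\<Union>i. V i) \<and>
      (\<forall>i. bounded (V i) \<and> diameter (V i) \<le> \<delta>) \<and>
      (\<Sum>i. ennreal (hausdorff_weight \<beta> (V i))) \<le> ennreal e"
    by (intro exI[of _ ?V] conjI)
qed

text \<open>Vitali's covering lemma turns the pointwise lower bounds on the integral of \<open>f\<close> into a bound on the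
content: the chosen balls are disjoint and lie in \<open>U\<close>, so their integrals sum to at most
\<open>\<integral>\<^bsub>U\<^esub> f\<close>. Asking for every factor \<open>c\<close>, and not merely for some \<open>c > 0\<close>, is what makes the measure zero
and not only finite.\<close>

lemma hausdorff_null_of_large_density:
  fixes f :: "'a::euclidean_space \<Rightarrow> real"
  assumes "\<beta> \<ge> 0" and "open U" and "A \<subseteq> U"
    and f: "set_integrable lebesgue U f" "\<And>x. 0 \<le> f x"
    and dens: "\<And>x c \<delta>. x \<in> A \<Longrightarrow> 0 < c \<Longrightarrow> 0 < \<delta> \<Longrightarrow>
        \<exists>r. 0 < r \<and> r < \<delta> \<and> c * r powr \<beta> \<le> (LINT y:ball x r|lebesgue. f y)"
  shows "hausdorff_measure \<beta> A = 0"
  unfolding hausdorff_measure_eq_0_iff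
proof (intro allI impI)
  fix \<delta> e :: real assume "\<delta> > 0" "e > 0"
  define I where "I = (LINT y:U|lebesgue. f y)"
  have U[measurable]: "U \<in> sets lebesgue" using \<open>open U\<close> by simp
  have I0: "I \<ge> 0" unfolding I_def set_lebesgue_integral_def by (rule integral_nonneg_AE) (use f in auto)
  \<comment> \<open>The cover below has weight at most \<open>unit_ball_vol \<beta> * 5 powr \<beta> * I / c\<close>; adding 1 keeps \<open>c\<close>
      positive when \<open>I = 0\<close>.\<close>
  define c where "c = (unit_ball_vol \<beta> * 5 powr \<beta> * I + 1) / e"
  have ubv: "unit_ball_vol \<beta> \<ge> 0" using \<open>\<beta> \<ge> 0\<close> by simp
  then have "c > 0" using I0 \<open>e > 0\<close> by (auto simp: c_def intro!: divide_pos_pos add_nonneg_pos)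
  have "\<exists>r. 0 < r \<and> r < \<delta> / 10 \<and> ball x r \<subseteq> U \<and> c * r powr \<beta> \<le> (LINT y:ball x r|lebesgue. f y)"
    if "x \<in> A" for x
  proof -
    obtain s where s: "s > 0" "ball x s \<subseteq> U"
      using \<open>open U\<close> \<open>A \<subseteq> U\<close> \<open>x \<in> A\<close> by (meson open_contains_ball subsetD)
    obtain r where "0 < r" "r < min s (\<delta>/10)" "c * r powr \<beta> \<le> (LINT y:ball x r|lebesgue. f y)"
      using dens[OF \<open>x \<in> A\<close> \<open>c > 0\<close>, of "min s (\<delta>/10)"] \<open>s > 0\<close> \<open>\<delta> > 0\<close> by auto
    moreover have "ball x r \<subseteq> U" using \<open>r < min s (\<delta>/10)\<close> s(2) subset_ball[of r s x] by auto
    ultimately show ?thesis by auto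
  qed
  then obtain r where r: "\<And>x. x \<in> A \<Longrightarrow> 0 < r x" "\<And>x. x \<in> A \<Longrightarrow> r x < \<delta> / 10"
    "\<And>x. x \<in> A \<Longrightarrow> ball x (r x) \<subseteq> U"
    "\<And>x. x \<in> A \<Longrightarrow> c * r x powr \<beta> \<le> (LINT y:ball x (r x)|lebesgue. f y)"
    by metis
  have cov: "A \<subseteq> (\<Union>x\<in>A. cball x (r x))" using r(1) by force
  obtain C where C: "countable C" "C \<subseteq> A"
    "pairwise (\<lambda>x y. disjnt (cball x (r x)) (cball y (r y))) C"
    "A \<subseteq> (\<Union>x\<in>C. cball x (5 * r x))"
    by (rule Vitali_covering_lemma_cballs[OF cov, of "\<delta>/10"])
      (use r(1,2) in \<open>force simp: less_imp_le\<close>, rule that)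
  let ?\<mu> = "density lebesgue (\<lambda>y. ennreal (indicator U y * f y))"
  have fm[measurable]: "(\<lambda>y. indicator U y * f y) \<in> borel_measurable lebesgue"
    using borel_measurable_integrable[OF f(1)[unfolded set_integrable_def]] by simp
  have mu: "emeasure ?\<mu> S = ennreal (LINT y:S|lebesgue. f y)"
    if S: "S \<in> sets lebesgue" "S \<subseteq> U" for S
  proof -
    have i: "set_integrable lebesgue S f" using set_integrable_subset[OF f(1) S] .
    have "emeasure ?\<mu> S = (\<integral>\<^sup>+y. ennreal (indicator U y * f y) * indicator S y \<partial>lebesgue)"
      using S by (intro emeasure_density) auto
    also have "\<dots> = (\<integral>\<^sup>+y. ennreal (indicator S y *\<^sub>R f y) \<partial>lebesgue)"
      by (intro nn_integral_cong) (use S in \<open>auto split: split_indicator\<close>)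
    also have "\<dots> = ennreal (LINT y:S|lebesgue. f y)"
      unfolding set_lebesgue_integral_def
      by (rule nn_integral_eq_integral) (use i f(2) in \<open>auto simp: set_integrable_def\<close>)
    finally show ?thesis .
  qed
  have disj: "disjoint_family_on (\<lambda>x. ball x (r x)) C"
    unfolding disjoint_family_on_def
  proof (intro ballI impI)
    fix x y assume "x \<in> C" "y \<in> C" "x \<noteq> y"
    then have "disjnt (cball x (r x)) (cball y (r y))" using C(3) by (simp add: pairwise_def)
    then show "ball x (r x) \<inter> ball y (r y) = {}"
      unfolding disjnt_def using ball_subset_cball by blast
  qed
  have bound: "ennreal (hausdorff_weight \<beta> (cball x (5 * r x)))
      \<le> ennreal (unit_ball_vol \<beta> * 5 powr \<beta> / c) * emeasure ?\<mu> (ball x (r x))" if "x \<in> C" for x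
  proof -
    have x: "x \<in> A" "0 < r x" using that C(2) r(1) by auto
    have "hausdorff_weight \<beta> (cball x (5 * r x)) = unit_ball_vol \<beta> * (5 * r x) powr \<beta>"
      using x by (auto simp: hausdorff_weight_def)
    also have "\<dots> = (unit_ball_vol \<beta> * 5 powr \<beta> / c) * (c * r x powr \<beta>)"
      using \<open>c > 0\<close> x by (simp add: powr_mult)
    also have "\<dots> \<le> (unit_ball_vol \<beta> * 5 powr \<beta> / c) * (LINT y:ball x (r x)|lebesgue. f y)"
      using r(4)[OF x(1)] \<open>c > 0\<close> ubv by (intro mult_left_mono) auto
    finally have "ennreal (hausdorff_weight \<beta> (cball x (5 * r x)))
      \<le> ennreal ((unit_ball_vol \<beta> * 5 powr \<beta> / c) * (LINT y:ball x (r x)|lebesgue. f y))"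
      by (rule ennreal_leI)
    then show ?thesis using mu[of "ball x (r x)"] r(3)[OF x(1)] \<open>c > 0\<close> ubv
      by (subst (asm) ennreal_mult') auto
  qed
  \<comment> \<open>A cover is indexed by all naturals, while \<open>C\<close> may be finite; the empty set has weight 0.\<close>
  let ?n = "to_nat_on C" and ?V = "\<lambda>i. if i \<in> to_nat_on C ` C then cball (from_nat_into C i) (5 * r (from_nat_into C i)) else {}"
  have bij: "bij_betw ?n C (?n ` C)"
    using C(1) by (simp add: inj_on_to_nat_on inj_on_imp_bij_betw)
  have "(\<Sum>i. ennreal (hausdorff_weight \<beta> (?V i)))
      = (\<integral>\<^sup>+i. ennreal (hausdorff_weight \<beta> (?V i)) \<partial>count_space UNIV)"
    by (simp add: nn_integral_count_space_nat)
  also have "\<dots> = (\<integral>\<^sup>+i. ennreal (hausdorff_weight \<beta> (?V i)) \<partial>count_space (?n ` C))"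
    by (rule nn_integral_count_space_eq) (auto simp: hausdorff_weight_def)
  also have "\<dots> = (\<integral>\<^sup>+x. ennreal (hausdorff_weight \<beta> (?V (?n x))) \<partial>count_space C)"
    by (rule nn_integral_bij_count_space[OF bij, symmetric])
  also have "\<dots> \<le> (\<integral>\<^sup>+x. ennreal (unit_ball_vol \<beta> * 5 powr \<beta> / c) * emeasure ?\<mu> (ball x (r x)) \<partial>count_space C)"
    by (rule nn_integral_mono) (use bound C(1) in auto)
  also have "\<dots> = ennreal (unit_ball_vol \<beta> * 5 powr \<beta> / c) * emeasure ?\<mu> (\<Union>x\<in>C. ball x (r x))"
    using C(1) disj by (subst emeasure_UN_countable) (auto simp: nn_integral_cmult)
  also have "\<dots> \<le> ennreal (unit_ball_vol \<beta> * 5 powr \<beta> / c) * emeasure ?\<mu> U"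
    by (intro mult_left_mono emeasure_mono) (use C(2) r(3) in auto)
  also have "\<dots> = ennreal (unit_ball_vol \<beta> * 5 powr \<beta> / c * I)"
    unfolding mu[OF U order_refl] I_def[symmetric] using \<open>c > 0\<close> ubv
    by (intro ennreal_mult'[symmetric]) auto
  also have "\<dots> \<le> ennreal e"
  proof (rule ennreal_leI)
    have "unit_ball_vol \<beta> * 5 powr \<beta> * I \<le> e * c" using \<open>e > 0\<close> by (simp add: c_def)
    then show "unit_ball_vol \<beta> * 5 powr \<beta> / c * I \<le> e" using \<open>c > 0\<close> by (simp add: field_simps)
  qed
  finally have "(\<Sum>i. ennreal (hausdorff_weight \<beta> (?V i))) \<le> ennreal e" .
  moreover have "A \<subseteq> (\<Union>i. ?V i)"
  proof
    fix y assume "y \<in> A"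
    then obtain x where x: "x \<in> C" "y \<in> cball x (5 * r x)" using C(4) by blast
    then have "y \<in> ?V (?n x)" using C(1) by simp
    then show "y \<in> (\<Union>i. ?V i)" by (rule UN_I[OF UNIV_I])
  qed
  moreover have "\<forall>i. bounded (?V i) \<and> diameter (?V i) \<le> \<delta>"
  proof
    fix i
    have "10 * r x \<le> \<delta>" if "x \<in> C" for x using r(2)[of x] C(2) that by auto
    then show "bounded (?V i) \<and> diameter (?V i) \<le> \<delta>" using C(1) \<open>\<delta> > 0\<close> by auto
  qed
  ultimately show "\<exists>V::nat \<Rightarrow> 'a set. A \<subseteq> (\<Union>i. V i) \<and>
      (\<forall>i. bounded (V i) \<and> diameter (V i) \<le> \<delta>) \<and>
      (\<Sum>i. ennreal (hausdorff_weight \<beta> (V i))) \<le> ennreal e"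
    by (intro exI[of _ ?V] conjI)
qed

section \<open>A smooth function vanishing on a half line\<close>

text \<open>Every derivative of \<open>exp (- 1 / t)\<close> is a polynomial in \<open>1 / t\<close> times \<open>exp (- 1 / t)\<close>; the recursion is the
product rule, with \<open>(1 / t)' = - (1 / t)\<^sup>2\<close>.\<close>

primrec exp_inv_poly :: "nat \<Rightarrow> real poly" where
  "exp_inv_poly 0 = 1"
| "exp_inv_poly (Suc n) = monom 1 2 * (exp_inv_poly n - pderiv (exp_inv_poly n))"

text \<open>The \<open>n\<close>-th derivative of the function that is \<open>exp (- 1 / t)\<close> for \<open>t > 0\<close> and \<open>0\<close> elsewhere. Carrying the whole
sequence of derivatives along makes smoothness a statement about consecutive terms.\<close>

definition exp_inv :: "nat \<Rightarrow> real \<Rightarrow> real"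
  where "exp_inv n t = (if t > 0 then poly (exp_inv_poly n) (1 / t) * exp (- 1 / t) else 0)"

lemma poly_over_exp_tendsto_0: "((\<lambda>x. poly p x / exp x) \<longlongrightarrow> (0::real)) at_top"
proof -
  have "((\<lambda>x. \<Sum>i\<le>degree p. coeff p i * (x ^ i / exp x)) \<longlongrightarrow> (\<Sum>i\<le>degree p. coeff p i * 0)) at_top"
    by (intro tendsto_intros tendsto_power_div_exp_0)
  then show ?thesis by (simp add: poly_altdef sum_divide_distrib)
qed

lemma exp_inv_derivative: "(exp_inv n has_real_derivative exp_inv (Suc n) t) (at t)"
proof -
  consider "t > 0" | "t < 0" | "t = 0" by linarith
  then show ?thesis
  proof cases
    case 1
    have "((\<lambda>t. poly (exp_inv_poly n) (1 / t) * exp (- 1 / t)) has_real_derivative exp_inv (Suc n) t) (at t)"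
      using 1 by (auto intro!: derivative_eq_intros simp: exp_inv_def poly_monom field_simps power2_eq_square)
    then show ?thesis
      by (rule has_field_derivative_transform_within_open[of _ _ _ "{0<..}"])
        (use 1 in \<open>auto simp: exp_inv_def\<close>)
  next
    case 2
    have "((\<lambda>t. 0) has_real_derivative exp_inv (Suc n) t) (at t)"
      using 2 by (simp add: exp_inv_def)
    then show ?thesis
      by (rule has_field_derivative_transform_within_open[of _ _ _ "{..<0}"])
        (use 2 in \<open>auto simp: exp_inv_def\<close>)
  next
    case 3
    let ?q = "\<lambda>x. poly (monom 1 1 * exp_inv_poly n) x / exp x"
    have "((\<lambda>h. ?q (inverse h)) \<longlongrightarrow> 0) (at_right 0)"
      by (rule filterlim_compose[OF poly_over_exp_tendsto_0 filterlim_inverse_at_top_right])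
    then have R: "((\<lambda>h. exp_inv n h / h) \<longlongrightarrow> 0) (at_right 0)"
      by (rule Lim_transform_eventually)
        (auto simp: eventually_at_right_field exp_inv_def poly_monom exp_minus field_simps intro!: exI[of _ 1])
    have "((\<lambda>h. exp_inv n h / h) \<longlongrightarrow> 0) (at_left 0)"
      by (rule Lim_transform_eventually[OF tendsto_const])
        (auto simp: eventually_at_left_field exp_inv_def intro!: exI[of _ "-1"])
    with R have "((\<lambda>h. exp_inv n h / h) \<longlongrightarrow> 0) (at 0)"
      by (simp add: filterlim_at_split)
    then show ?thesis
      using 3 by (simp add: DERIV_def exp_inv_def)
  qed
qed

lemma exp_inv_0_bounds: "0 \<le> exp_inv 0 t" "exp_inv 0 t \<le> 1"
  by (auto simp: exp_inv_def)

lemma exp_inv_1_bounds: "0 \<le> exp_inv (Suc 0) t" "exp_inv (Suc 0) t \<le> 2"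
proof -
  have "s\<^sup>2 * exp (- s) \<le> 2" if "s \<ge> 0" for s :: real
  proof -
    have "s\<^sup>2 \<le> 2 * exp s" using exp_lower_Taylor_quadratic[OF that] that by simp
    then show ?thesis by (simp add: exp_minus field_simps)
  qed
  from this[of "1 / t"] show "exp_inv (Suc 0) t \<le> 2" 
    by (auto simp: exp_inv_def poly_monom)
  show "0 \<le> exp_inv (Suc 0) t" by (auto simp: exp_inv_def poly_monom)
qed

lemma partial_deriv_eq:
  assumes "(f has_derivative f') (at x)"
  shows "partial_deriv j f x = f' (axis j 1)"
  using frechet_derivative_at[OF assms] by (simp add: partial_deriv_def)

lemma Ck_SucD: "Ck (Suc k) f \<Longrightarrow> Ck k f"
proof (induction k arbitrary: f)
  case 0
  then show ?case
    by (auto simp: continuous_on_eq_continuous_at intro: differentiable_imp_continuous_within)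
qed simp

lemma Ck_const: "Ck k (\<lambda>x::real^'n. c::'b::real_normed_vector)"
proof (induction k arbitrary: c)
  case (Suc k)
  have "partial_deriv j (\<lambda>x. c) = (\<lambda>x::real^'n. 0::'b)" for j and c :: 'b
    by (rule ext, subst partial_deriv_eq[OF has_derivative_const]) simp
  with Suc show ?case by simp
qed simp

lemma Ck_nth: "Ck k (\<lambda>x. x $ i)"
proof (cases k)
  case 0
  then show ?thesis by (simp add: continuous_on_component)
next
  case (Suc m)
  have d: "((\<lambda>x. x $ i) has_derivative (\<lambda>h. h $ i)) (at x)" for x :: "real^'a"
    by (rule bounded_linear_imp_has_derivative) (rule bounded_linear_vec_nth)
  then have "partial_deriv j (\<lambda>x. x $ i) = (\<lambda>x::real^'a. axis j 1 $ i)" for j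
    by (intro ext) (rule partial_deriv_eq)
  with Suc d show ?thesis by (auto simp: Ck_const differentiable_def)
qed

lemma Ck_add: "Ck k f \<Longrightarrow> Ck k g \<Longrightarrow> Ck k (\<lambda>x. f x + g x)"
proof (induction k arbitrary: f g)
  case (Suc k)
  have "partial_deriv j (\<lambda>x. f x + g x) = (\<lambda>x. partial_deriv j f x + partial_deriv j g x)" for j
  proof
    fix x
    show "partial_deriv j (\<lambda>x. f x + g x) x = partial_deriv j f x + partial_deriv j g x"
      using Suc.prems unfolding partial_deriv_def[of _ f] partial_deriv_def[of _ g]
      by (subst partial_deriv_eq[OF has_derivative_add]) (auto simp: frechet_derivative_works)
  qed
  with Suc show ?case by simp
qed (simp add: continuous_on_add)

lemma Ck_mult:
  fixes f g :: "real^'n \<Rightarrow> real"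
  shows "Ck k f \<Longrightarrow> Ck k g \<Longrightarrow> Ck k (\<lambda>x. f x * g x)"
proof (induction k arbitrary: f g)
  case (Suc k)
  have "partial_deriv j (\<lambda>x. f x * g x) = (\<lambda>x. f x * partial_deriv j g x + partial_deriv j f x * g x)" for j
  proof
    fix x
    show "partial_deriv j (\<lambda>x. f x * g x) x = f x * partial_deriv j g x + partial_deriv j f x * g x"
      using Suc.prems unfolding partial_deriv_def[of _ f] partial_deriv_def[of _ g]
      by (subst partial_deriv_eq[OF has_derivative_mult]) (auto simp: frechet_derivative_works)
  qed
  moreover have "Ck k f" "Ck k g" using Suc.prems Ck_SucD by blast+
  ultimately show ?case using Suc by (auto intro!: Ck_add)
qed (simp add: continuous_on_mult)

lemma Ck_sum: "finite I \<Longrightarrow> (\<And>i. i \<in> I \<Longrightarrow> Ck k (f i)) \<Longrightarrow> Ck k (\<lambda>x. \<Sum>i\<in>I. f i x)"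
  by (induction rule: finite_induct) (auto intro: Ck_const Ck_add)

text \<open>The chain rule produces \<open>D (Suc n)\<close> from \<open>D n\<close>, so the induction needs the claim for all terms of the
sequence of derivatives at once.\<close>

lemma Ck_compose:
  fixes u :: "real^'n \<Rightarrow> real" and D :: "nat \<Rightarrow> real \<Rightarrow> real"
  assumes D: "\<And>n t. (D n has_real_derivative D (Suc n) t) (at t)"
  shows "Ck k u \<Longrightarrow> Ck k (\<lambda>x. D n (u x))"
proof (induction k arbitrary: n)
  case 0
  have "continuous_on UNIV (D n)"
    using D by (intro DERIV_continuous_on) (auto intro: has_field_derivative_at_within)
  with 0 show ?case by (auto intro: continuous_on_compose2)
next
  case (Suc k)
  have d: "((\<lambda>x. D n (u x)) has_derivative (\<lambda>h. frechet_derivative u (at x) h * D (Suc n) (u x))) (at x)" for x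
  proof -
    have "(u has_derivative frechet_derivative u (at x)) (at x)"
      using Suc.prems by (simp add: frechet_derivative_works)
    moreover have "(D n has_derivative (\<lambda>h. h * D (Suc n) (u x))) (at (u x))"
      using D[of n "u x"] by (simp add: has_field_derivative_def mult_commute_abs)
    ultimately show ?thesis by (rule has_derivative_compose)
  qed
  then have "partial_deriv j (\<lambda>x. D n (u x)) = (\<lambda>x. partial_deriv j u x * D (Suc n) (u x))" for j
    by (intro ext) (subst partial_deriv_eq[OF d], simp add: partial_deriv_def)
  moreover have "Ck k (\<lambda>x. D (Suc n) (u x))" using Suc Ck_SucD by blast
  ultimately show ?case using d Suc.prems by (auto intro!: Ck_mult simp: differentiable_def)
qed

section \<open>Smooth cutoffs of a ball\<close>

text \<open>The function \<open>exp_inv 0\<close> of this argument is a smooth radial bump supported in the closed ball of radius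
\<open>r\<close>. It equals \<open>exp (- 1 / (N q))\<close> with \<open>q = 1 - |x - a|\<^sup>2 / r\<^sup>2\<close> inside the ball, hence increases to the
indicator of the open ball as \<open>N\<close> tends to infinity.\<close>

definition cutoff_arg :: "real \<Rightarrow> real^'n \<Rightarrow> real \<Rightarrow> real^'n \<Rightarrow> real"
  where "cutoff_arg N a r x = N * (1 - (norm (x - a))\<^sup>2 / r\<^sup>2)"

definition cutoff :: "real \<Rightarrow> real^'n \<Rightarrow> real \<Rightarrow> real^'n \<Rightarrow> real"
  where "cutoff N a r x = exp_inv 0 (cutoff_arg N a r x)"

text \<open>The divergence of the vector field \<open>(x - a) * cutoff N a r x\<close>, as \<open>sum_partial_deriv_cutoff_field\<close> shows.\<close>

definition cutoff_div :: "real \<Rightarrow> real^'n \<Rightarrow> real \<Rightarrow> real^'n \<Rightarrow> real"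
  where "cutoff_div N a r x =
    real CARD('n) * cutoff N a r x - 2 * N * ((norm (x - a))\<^sup>2 / r\<^sup>2) * exp_inv (Suc 0) (cutoff_arg N a r x)"

lemma cutoff_arg_nonpos:
  assumes "N \<ge> 0" "r > 0" "x \<notin> ball a r"
  shows "cutoff_arg N a r x \<le> 0"
proof -
  have "r\<^sup>2 \<le> (norm (x - a))\<^sup>2"
    using assms by (intro power_mono) (auto simp: dist_norm norm_minus_commute)
  then have "1 - (norm (x - a))\<^sup>2 / r\<^sup>2 \<le> 0" using \<open>r > 0\<close> by simp
  then show ?thesis using \<open>N \<ge> 0\<close> by (simp add: cutoff_arg_def mult_nonneg_nonpos)
qed

lemma cutoff_bounds: "0 \<le> cutoff N a r x" "cutoff N a r x \<le> 1"
  using exp_inv_0_bounds by (auto simp: cutoff_def)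

lemma abs_cutoff_le: "\<bar>cutoff N a r x\<bar> \<le> 1"
  using cutoff_bounds[of N a r x] by simp

lemma cutoff_eq_0: "N \<ge> 0 \<Longrightarrow> r > 0 \<Longrightarrow> x \<notin> ball a r \<Longrightarrow> cutoff N a r x = 0"
  using cutoff_arg_nonpos by (fastforce simp: cutoff_def exp_inv_def)

lemma cutoff_div_eq_0: "N \<ge> 0 \<Longrightarrow> r > 0 \<Longrightarrow> x \<notin> ball a r \<Longrightarrow> cutoff_div N a r x = 0"
  using cutoff_arg_nonpos cutoff_eq_0 by (fastforce simp: cutoff_div_def exp_inv_def)

lemma abs_cutoff_div_le:
  fixes a :: "real^'n" and N r :: real
  assumes "N \<ge> 0" "r > 0"
  shows "\<bar>cutoff_div N a r x\<bar> \<le> CARD('n) + 4 * N"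
proof (cases "x \<in> ball a r")
  case True
  then have "(norm (x - a))\<^sup>2 / r\<^sup>2 \<le> 1"
    using \<open>r > 0\<close> by (simp add: dist_norm norm_minus_commute power_mono)
  then have "((norm (x - a))\<^sup>2 / r\<^sup>2) * exp_inv (Suc 0) (cutoff_arg N a r x) \<le> 1 * 2"
    by (intro mult_mono exp_inv_1_bounds) auto
  then have "2 * N * (((norm (x - a))\<^sup>2 / r\<^sup>2) * exp_inv (Suc 0) (cutoff_arg N a r x)) \<le> 2 * N * 2"
    using \<open>N \<ge> 0\<close> by (intro mult_left_mono) auto
  moreover have "0 \<le> 2 * N * (((norm (x - a))\<^sup>2 / r\<^sup>2) * exp_inv (Suc 0) (cutoff_arg N a r x))"
    using \<open>N \<ge> 0\<close> exp_inv_1_bounds by (intro mult_nonneg_nonneg) auto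
  moreover have "0 \<le> real CARD('n) * cutoff N a r x" "real CARD('n) * cutoff N a r x \<le> real CARD('n)"
    using cutoff_bounds[of N a r x] by (auto intro: mult_left_le)
  ultimately show ?thesis unfolding cutoff_div_def mult.assoc[symmetric] abs_le_iff by linarith
next
  case False
  with assms show ?thesis by (simp add: cutoff_div_eq_0)
qed

lemma continuous_on_exp_inv: "continuous_on A (exp_inv n)"
  by (rule DERIV_continuous_on) (auto intro: has_field_derivative_at_within exp_inv_derivative)

lemma continuous_on_cutoff: "continuous_on A (cutoff N a r)"
  unfolding cutoff_def cutoff_arg_def divide_inverse
  by (intro continuous_on_compose2[OF continuous_on_exp_inv[of UNIV]] continuous_intros) auto

lemma continuous_on_cutoff_div: "continuous_on A (cutoff_div N a r)"
  unfolding cutoff_div_def cutoff_arg_def divide_inverse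
  by (intro continuous_intros continuous_on_cutoff[unfolded eta_contract_eq]
      continuous_on_compose2[OF continuous_on_exp_inv[of UNIV]]) auto

lemma Ck_cutoff_field: "Ck k (\<lambda>x. (x $ j - a $ j) * cutoff N a r x)"
proof -
  have "Ck k (\<lambda>x. N + (- N / r\<^sup>2) * (\<Sum>i\<in>UNIV. (x $ i + - a $ i) * (x $ i + - a $ i)))"
    by (intro Ck_add Ck_mult Ck_const Ck_sum Ck_nth finite)
  also have "(\<lambda>x. N + (- N / r\<^sup>2) * (\<Sum>i\<in>UNIV. (x $ i + - a $ i) * (x $ i + - a $ i))) = cutoff_arg N a r"
    by (auto simp: cutoff_arg_def power2_norm_eq_inner inner_vec_def field_simps)
  finally have "Ck k (\<lambda>x. exp_inv 0 (cutoff_arg N a r x))"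
    by (rule Ck_compose[of exp_inv, OF exp_inv_derivative])
  then have "Ck k (\<lambda>x. (x $ j + - a $ j) * cutoff N a r x)"
    unfolding cutoff_def by (intro Ck_mult Ck_add Ck_const Ck_nth)
  then show ?thesis by simp
qed

lemma test_function_cutoff_field:
  assumes "N \<ge> 0" "r > 0" "cball a r \<subseteq> \<Omega>"
  shows "test_function \<Omega> (\<lambda>x. (x $ j - a $ j) * cutoff N a r x)"
proof -
  let ?S = "{x. (x $ j - a $ j) * cutoff N a r x \<noteq> 0}"
  have "?S \<subseteq> cball a r"
    using cutoff_eq_0[OF assms(1,2), of _ a] ball_subset_cball by fastforce
  then have "closure ?S \<subseteq> cball a r" by (simp add: closure_minimal)
  moreover from this have "compact (closure ?S)"
    by (meson bounded_cball bounded_subset closed_closure compact_eq_bounded_closed)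
  ultimately show ?thesis
    unfolding test_function_def using Ck_cutoff_field assms(3) by blast
qed

lemma partial_deriv_cutoff_field:
  "partial_deriv j (\<lambda>x. (x $ j - a $ j) * cutoff N a r x) x =
    cutoff N a r x - 2 * N * ((x $ j - a $ j)\<^sup>2 / r\<^sup>2) * exp_inv (Suc 0) (cutoff_arg N a r x)"
proof -
  let ?u = "cutoff_arg N a r"
  have u: "(?u has_derivative (\<lambda>h. - (2 * N / r\<^sup>2) * ((x - a) \<bullet> h))) (at x)"
  proof -
    have "((\<lambda>x. (x - a) \<bullet> (x - a)) has_derivative (\<lambda>h. (x - a) \<bullet> (h - 0) + (h - 0) \<bullet> (x - a))) (at x)"
      by (intro has_derivative_inner has_derivative_diff has_derivative_ident has_derivative_const)
    then have "((\<lambda>x. N + (- N / r\<^sup>2) * ((x - a) \<bullet> (x - a))) has_derivative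
        (\<lambda>h. 0 + (- N / r\<^sup>2) * ((x - a) \<bullet> (h - 0) + (h - 0) \<bullet> (x - a)))) (at x)"
      by (intro has_derivative_add has_derivative_mult_right has_derivative_const)
    moreover have "?u = (\<lambda>x. N + (- N / r\<^sup>2) * ((x - a) \<bullet> (x - a)))"
      unfolding cutoff_arg_def[abs_def] power2_norm_eq_inner by (simp add: field_simps)
    ultimately show ?thesis by (simp add: inner_commute mult.assoc mult.left_commute)
  qed
  have "(exp_inv 0 has_derivative (\<lambda>h. h * exp_inv (Suc 0) (?u x))) (at (?u x))"
    using exp_inv_derivative[of 0 "?u x"] by (simp add: has_field_derivative_def mult_commute_abs)
  from has_derivative_compose[OF u this]
  have c: "(cutoff N a r has_derivative
      (\<lambda>h. - (2 * N / r\<^sup>2) * ((x - a) \<bullet> h) * exp_inv (Suc 0) (?u x))) (at x)"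
    by (simp add: cutoff_def[abs_def])
  have "((\<lambda>x. x $ j - a $ j) has_derivative (\<lambda>h. h $ j)) (at x)"
    by (auto intro!: derivative_eq_intros bounded_linear_imp_has_derivative bounded_linear_vec_nth)
  from has_derivative_mult[OF this c] show ?thesis
    by (subst partial_deriv_eq) (auto simp: inner_axis power2_eq_square field_simps)
qed

lemma sum_partial_deriv_cutoff_field:
  "(\<Sum>j\<in>UNIV. partial_deriv j (\<lambda>x. (x $ j - a $ j) * cutoff N a r x) x) = cutoff_div N a r x"
proof -
  have "(\<Sum>j\<in>UNIV. (x $ j - a $ j)\<^sup>2) = (norm (x - a))\<^sup>2"
    unfolding power2_norm_eq_inner by (simp add: inner_vec_def power2_eq_square)
  then show ?thesis
    by (simp add: partial_deriv_cutoff_field cutoff_div_def sum_subtractf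
        flip: sum_distrib_left sum_distrib_right sum_divide_distrib)
qed

text \<open>The kernel \<open>r\<^sup>-\<^sup>n \<eta>((x - a) / r)\<close> has constant mass, so its derivative in \<open>r\<close> must be a divergence; for a radial
dilation the field is \<open>- (x - a) / r\<close> times the kernel.\<close>

lemma cutoff_scaling_derivative:
  fixes a :: "real^'n"
  assumes "r > 0"
  shows "((\<lambda>r. cutoff N a r x / r ^ CARD('n)) has_real_derivative
      - cutoff_div N a r x / r ^ Suc CARD('n)) (at r)"
proof -
  have "((\<lambda>r. cutoff_arg N a r x) has_real_derivative 2 * N * (norm (x - a))\<^sup>2 / r ^ 3) (at r)"
    unfolding cutoff_arg_def using assms
    by (auto intro!: derivative_eq_intros simp: field_simps power2_eq_square power3_eq_cube)
  from DERIV_chain2[OF exp_inv_derivative[of 0] this]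
  have c: "((\<lambda>r. cutoff N a r x) has_real_derivative
      exp_inv (Suc 0) (cutoff_arg N a r x) * (2 * N * (norm (x - a))\<^sup>2 / r ^ 3)) (at r)"
    by (simp add: cutoff_def)
  have p: "((\<lambda>r. r ^ CARD('n)) has_real_derivative real CARD('n) * r ^ (CARD('n) - 1)) (at r)"
    using DERIV_pow[of "CARD('n)" r] by simp
  have n: "r ^ CARD('n) = r * r ^ (CARD('n) - 1)"
    using power_Suc[of r "CARD('n) - 1"] by simp
  show ?thesis
    by (rule DERIV_cong[OF DERIV_divide[OF c p]])
      (use assms in \<open>simp_all add: n cutoff_div_def field_simps power2_eq_square power3_eq_cube\<close>)
qed

lemma cutoff_tendsto_indicator:
  assumes "r > 0"
  shows "(\<lambda>n. cutoff (real n) a r x) \<longlonglongrightarrow> indicator (ball a r) x"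
proof (cases "x \<in> ball a r")
  case True
  define q where "q = 1 - (norm (x - a))\<^sup>2 / r\<^sup>2"
  have "(norm (x - a))\<^sup>2 < r\<^sup>2"
    using True by (intro power_strict_mono) (auto simp: dist_norm norm_minus_commute)
  then have "q > 0" using assms by (simp add: q_def)
  have "(\<lambda>n. exp ((1 / real n) * (- 1 / q))) \<longlonglongrightarrow> exp (0 * (- 1 / q))"
    by (intro tendsto_intros lim_1_over_n)
  then have "(\<lambda>n. exp ((1 / real n) * (- 1 / q))) \<longlonglongrightarrow> indicator (ball a r) x"
    using True by simp
  moreover have "\<forall>\<^sub>F n in sequentially. exp ((1 / real n) * (- 1 / q)) = cutoff (real n) a r x"
    using eventually_gt_at_top[of "0::nat"]
    by eventually_elim
      (use \<open>q > 0\<close> in \<open>simp add: cutoff_def cutoff_arg_def exp_inv_def q_def[symmetric]\<close>)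
  ultimately show ?thesis by (rule Lim_transform_eventually)
next
  case False
  then show ?thesis using assms by (simp add: cutoff_eq_0)
qed

section \<open>Smooth averages and their derivative in the radius\<close>

text \<open>Differentiation under the integral sign: by the mean value inequality the difference quotients inherit
the majorant \<open>w\<close> of the derivative, and dominated convergence applies.\<close>

lemma has_real_derivative_integral:
  fixes g :: "real \<Rightarrow> 'a \<Rightarrow> real"
  assumes r0: "s < r0" "r0 < t"
    and int: "\<And>r. s < r \<Longrightarrow> r < t \<Longrightarrow> integrable M (g r)"
    and der: "\<And>r x. s < r \<Longrightarrow> r < t \<Longrightarrow> ((\<lambda>r. g r x) has_real_derivative g' r x) (at r)"
    and meas: "g' r0 \<in> borel_measurable M"
    and bnd: "\<And>r x. s < r \<Longrightarrow> r < t \<Longrightarrow> \<bar>g' r x\<bar> \<le> w x" and w: "integrable M w"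
  shows "((\<lambda>r. LINT x|M. g r x) has_real_derivative (LINT x|M. g' r0 x)) (at r0)"
  unfolding has_field_derivative_iff tendsto_at_iff_sequentially comp_def
proof (intro allI impI)
  fix X :: "nat \<Rightarrow> real"
  assume ne: "\<forall>i. X i \<in> UNIV - {r0}" and lim: "X \<longlonglongrightarrow> r0"
  have "\<forall>\<^sub>F n in sequentially. s < X n \<and> X n < t"
    using order_tendstoD[OF lim] r0 by (auto intro: eventually_conj)
  then obtain n0 where n0: "\<And>n. n \<ge> n0 \<Longrightarrow> s < X n \<and> X n < t"
    unfolding eventually_sequentially by blast
  define Y where "Y n = X (n + n0)" for n
  have Y: "s < Y n" "Y n < t" "Y n \<noteq> r0" for n
    using n0[of "n + n0"] ne by (auto simp: Y_def)
  have limY: "Y \<longlonglongrightarrow> r0" unfolding Y_def using lim by (rule LIMSEQ_ignore_initial_segment)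
  have "(\<lambda>n. LINT x|M. (g (Y n) x - g r0 x) / (Y n - r0)) \<longlonglongrightarrow> (LINT x|M. g' r0 x)"
  proof (rule integral_dominated_convergence[where w = w])
    show "(\<lambda>x. (g (Y n) x - g r0 x) / (Y n - r0)) \<in> borel_measurable M" for n
      using int[OF Y(1,2)] int[OF r0] by (intro borel_measurable_divide borel_measurable_diff) auto
    show "AE x in M. (\<lambda>n. (g (Y n) x - g r0 x) / (Y n - r0)) \<longlonglongrightarrow> g' r0 x"
    proof (rule AE_I2)
      fix x
      have "((\<lambda>y. (g y x - g r0 x) / (y - r0)) \<longlongrightarrow> g' r0 x) (at r0)"
        using der[OF r0, of x] by (simp add: has_field_derivative_iff)
      then show "(\<lambda>n. (g (Y n) x - g r0 x) / (Y n - r0)) \<longlonglongrightarrow> g' r0 x"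
        using Y(3) limY unfolding tendsto_at_iff_sequentially comp_def by simp
    qed
    show "AE x in M. norm ((g (Y n) x - g r0 x) / (Y n - r0)) \<le> w x" for n
    proof (rule AE_I2)
      fix x
      have "norm (g (Y n) x - g r0 x) \<le> w x * norm (Y n - r0)"
        by (rule field_differentiable_bound[of "{s<..<t}" "\<lambda>r. g r x" "\<lambda>r. g' r x"])
          (use der bnd Y r0 in \<open>auto intro: has_field_derivative_at_within\<close>)
      then show "norm ((g (Y n) x - g r0 x) / (Y n - r0)) \<le> w x"
        using Y(3)[of n] by (simp add: abs_divide divide_le_eq)
    qed
  qed (use meas w in auto)
  moreover have "(LINT x|M. (g (Y n) x - g r0 x) / (Y n - r0)) =
      ((LINT x|M. g (Y n) x) - (LINT x|M. g r0 x)) / (Y n - r0)" for n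
    using int[OF Y(1,2)] int[OF r0] by simp
  ultimately have "(\<lambda>n. ((LINT x|M. g (Y n) x) - (LINT x|M. g r0 x)) / (Y n - r0))
      \<longlonglongrightarrow> (LINT x|M. g' r0 x)" by (simp only:)
  then show "(\<lambda>n. ((LINT x|M. g (X n) x) - (LINT x|M. g r0 x)) / (X n - r0)) \<longlonglongrightarrow> (LINT x|M. g' r0 x)"
    unfolding Y_def by (rule LIMSEQ_offset)
qed

lemma L2_loc_integrable_square:
  "L2_loc \<Omega> f \<Longrightarrow> compact K \<Longrightarrow> K \<subseteq> \<Omega> \<Longrightarrow> set_integrable lebesgue K (\<lambda>x. (norm (f x))\<^sup>2)"
  by (simp add: L2_loc_def)

lemma L2_loc_measurable:
  assumes "L2_loc \<Omega> f" "K \<in> sets lebesgue" "K \<subseteq> \<Omega>"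
  shows "(\<lambda>x. indicator K x *\<^sub>R f x) \<in> borel_measurable lebesgue"
proof -
  have "(\<lambda>x. indicator \<Omega> x *\<^sub>R f x) \<in> borel_measurable lebesgue"
    using assms(1) by (simp add: L2_loc_def set_borel_measurable_def)
  then have "(\<lambda>x. indicator K x *\<^sub>R (indicator \<Omega> x *\<^sub>R f x)) \<in> borel_measurable lebesgue"
    by (rule borel_measurable_scaleR[OF borel_measurable_indicator[OF assms(2)]])
  also have "(\<lambda>x. indicator K x *\<^sub>R (indicator \<Omega> x *\<^sub>R f x)) = (\<lambda>x. indicator K x *\<^sub>R f x)"
    using assms(3) by (intro ext) (auto simp: indicator_def)
  finally show ?thesis .
qed

lemma L2_loc_integrable:
  assumes f: "L2_loc \<Omega> f" and K: "compact K" "K \<subseteq> \<Omega>"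
  shows "set_integrable lebesgue K f"
  unfolding set_integrable_def
proof (rule Bochner_Integration.integrable_bound)
  have K': "K \<in> lmeasurable" using K(1) by (rule lmeasurable_compact)
  then have "set_integrable lebesgue K (\<lambda>x. 1::real)"
    by (auto simp: set_integrable_def fmeasurable_def intro!: integrable_real_indicator)
  from set_integral_add(1)[OF this L2_loc_integrable_square[OF f K]]
  show "integrable lebesgue (\<lambda>x. indicator K x *\<^sub>R (1 + (norm (f x))\<^sup>2))"
    by (simp add: set_integrable_def)
  show "(\<lambda>x. indicator K x *\<^sub>R f x) \<in> borel_measurable lebesgue"
    using K' K(2) by (intro L2_loc_measurable[OF f]) auto
  have "norm (f x) \<le> 1 + (norm (f x))\<^sup>2" for x
    using sum_squares_bound[of 1 "norm (f x)"] by (simp add: power2_eq_square) (smt (verit) norm_ge_zero)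
  then show "AE x in lebesgue. norm (indicator K x *\<^sub>R f x) \<le> norm (indicator K x *\<^sub>R (1 + (norm (f x))\<^sup>2))"
    by (intro AE_I2) (auto simp: indicator_def)
qed

lemma integrable_mult_continuous:
  fixes b h :: "'a::euclidean_space \<Rightarrow> real"
  assumes b: "integrable lebesgue b" and h: "continuous_on UNIV h" "\<And>x. \<bar>h x\<bar> \<le> M"
  shows "integrable lebesgue (\<lambda>x. b x * h x)"
proof (rule Bochner_Integration.integrable_bound)
  show "integrable lebesgue (\<lambda>x. b x * M)" using b by simp
  have "h \<in> borel_measurable lebesgue"
    using borel_measurable_continuous_onI[OF h(1)] by (simp add: measurable_completion)
  then show "(\<lambda>x. b x * h x) \<in> borel_measurable lebesgue" using b by auto
  have "\<bar>b x\<bar> * \<bar>h x\<bar> \<le> \<bar>b x\<bar> * \<bar>M\<bar>" for x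
    using h(2)[of x] by (intro mult_left_mono) auto
  then show "AE x in lebesgue. norm (b x * h x) \<le> norm (b x * M)" by (simp add: abs_mult)
qed

lemma integral_indicator_component:
  fixes f :: "'a \<Rightarrow> real^'n"
  assumes "set_integrable M A f"
  shows "(LINT x:A|M. f x) $ i = (LINT x:A|M. f x $ i)"
proof -
  have "(LINT x|M. (indicator A x *\<^sub>R f x) $ i) = (LINT x|M. indicator A x *\<^sub>R f x) $ i"
    using assms unfolding set_integrable_def
    by (rule integral_bounded_linear[OF bounded_linear_vec_nth])
  then show ?thesis by (simp add: set_lebesgue_integral_def)
qed

text \<open>The derivative of the kernel is a divergence of a test field, which the weak formulation moves onto
\<open>B\<close>. Strictness of \<open>r < R\<close> leaves room to vary \<open>r\<close> while integrating over a fixed compact ball.\<close>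

lemma cutoff_average_derivative:
  fixes B :: "real^3 \<Rightarrow> real^3"
  assumes B: "L2_loc \<Omega> B" and G: "L2_loc \<Omega> G" and weak: "has_weak_gradient \<Omega> B G"
    and R: "cball a R \<subseteq> \<Omega>" and r: "0 < r" "r < R" and N: "0 \<le> N"
  shows "((\<lambda>r. LINT x:cball a R|lebesgue. B x $ i * (cutoff N a r x / r ^ 3)) has_real_derivative
     (\<Sum>j\<in>UNIV. LINT x:cball a R|lebesgue. G x $ i $ j * ((x $ j - a $ j) * cutoff N a r x)) / r ^ 4) (at r)"
proof -
  define b where "b x = indicator (cball a R) x * (B x $ i)" for x
  have b: "integrable lebesgue b"
    using integrable_bounded_linear[OF bounded_linear_vec_nth
        L2_loc_integrable[OF B compact_cball R, unfolded set_integrable_def], of i]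
    by (simp add: b_def[abs_def])
  have int: "integrable lebesgue (\<lambda>x. b x * (cutoff N a s x / s ^ 3))" if "s > 0" for s
  proof (rule integrable_mult_continuous[OF b])
    show "continuous_on UNIV (\<lambda>x. cutoff N a s x / s ^ 3)"
      using that by (intro continuous_intros continuous_on_cutoff) auto
    show "\<bar>cutoff N a s x / s ^ 3\<bar> \<le> 1 / s ^ 3" for x
      using that cutoff_bounds[of N a s x] by (simp add: abs_divide divide_right_mono)
  qed
  have intd: "integrable lebesgue (\<lambda>x. b x * cutoff_div N a r x)"
    by (rule integrable_mult_continuous[OF b continuous_on_cutoff_div abs_cutoff_div_le[OF N r(1)]])
  have "((\<lambda>r. LINT x|lebesgue. b x * (cutoff N a r x / r ^ 3)) has_real_derivative
      (LINT x|lebesgue. b x * (- cutoff_div N a r x / r ^ 4))) (at r)"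
  proof (rule has_real_derivative_integral[where s = "r / 2" and t = R
        and w = "\<lambda>x. \<bar>b x\<bar> * ((3 + 4 * N) / (r / 2) ^ 4)"])
    show "((\<lambda>r. b x * (cutoff N a r x / r ^ 3)) has_real_derivative
        b x * (- cutoff_div N a s x / s ^ 4)) (at s)" if "r / 2 < s" for s x
      using DERIV_cmult[OF cutoff_scaling_derivative[of s N a x], of "b x"] that r(1) by simp
    show "\<bar>b x * (- cutoff_div N a s x / s ^ 4)\<bar> \<le> \<bar>b x\<bar> * ((3 + 4 * N) / (r / 2) ^ 4)"
      if "r / 2 < s" for s x
    proof -
      have "\<bar>cutoff_div N a s x\<bar> / s ^ 4 \<le> (3 + 4 * N) / (r / 2) ^ 4"
        using abs_cutoff_div_le[OF N, of s a x] that r(1) N by (intro frac_le power_mono) auto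
      from mult_left_mono[OF this abs_ge_zero[of "b x"]] show ?thesis
        using that r(1) by (simp add: abs_mult abs_divide)
    qed
    show "(\<lambda>x. b x * (- cutoff_div N a r x / r ^ 4)) \<in> borel_measurable lebesgue"
      using borel_measurable_integrable[OF integrable_divide[OF integrable_minus[OF intd], of "r^4"]]
      by simp
  qed (use r int b in auto)
  moreover have "(LINT x|lebesgue. b x * (- cutoff_div N a r x / r ^ 4)) =
      - (LINT x|lebesgue. b x * cutoff_div N a r x) / r ^ 4"
    by simp
  moreover have "- (LINT x|lebesgue. b x * cutoff_div N a r x) =
      (\<Sum>j\<in>UNIV. LINT x:cball a R|lebesgue. G x $ i $ j * ((x $ j - a $ j) * cutoff N a r x))"
  proof -
    define \<phi> where "\<phi> j x = (x $ j - a $ j) * cutoff N a r x" for j and x :: "real^3"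
    have sub: "ball a r \<subseteq> cball a R" "cball a r \<subseteq> \<Omega>"
      using r R by auto
    have test: "test_function \<Omega> (\<phi> j)" for j
      unfolding \<phi>_def[abs_def] by (rule test_function_cutoff_field[OF N r(1) sub(2)])
    have off: "\<phi> j x = 0" "partial_deriv j (\<phi> j) x = 0" if "x \<notin> cball a R" for j x
    proof -
      have x: "x \<notin> ball a r" using that sub by auto
      show "\<phi> j x = 0" using cutoff_eq_0[OF N r(1) x] by (simp add: \<phi>_def)
      have "cutoff_arg N a r x \<le> 0" by (rule cutoff_arg_nonpos[OF N r(1) x])
      then show "partial_deriv j (\<phi> j) x = 0"
        unfolding \<phi>_def[abs_def] partial_deriv_cutoff_field
        using cutoff_eq_0[OF N r(1) x] by (simp add: exp_inv_def)
    qed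
    have intj: "integrable lebesgue (\<lambda>x. b x * partial_deriv j (\<phi> j) x)" for j
    proof -
      have "continuous_on UNIV (partial_deriv j (\<phi> j))"
        using test[of j] unfolding test_function_def by (metis Ck.simps)
      moreover have "bounded (partial_deriv j (\<phi> j) ` cball a R)"
        using calculation by (intro compact_imp_bounded compact_continuous_image)
          (auto intro: continuous_on_subset)
      then obtain M where M: "\<forall>x\<in>cball a R. \<bar>partial_deriv j (\<phi> j) x\<bar> \<le> M"
        by (auto simp: bounded_iff)
      have "\<bar>partial_deriv j (\<phi> j) x\<bar> \<le> \<bar>M\<bar>" for x
        using M off(2)[of x j] by (cases "x \<in> cball a R") force+
      ultimately show ?thesis using integrable_mult_continuous[OF b] by blast
    qed
    have restrict: "(LINT x:\<Omega>|lebesgue. p x * q x) = (LINT x:cball a R|lebesgue. p x * q x)"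
      if "\<And>x. x \<notin> cball a R \<Longrightarrow> q x = 0" for p q :: "real^3 \<Rightarrow> real"
      unfolding set_lebesgue_integral_def
      using that R by (intro Bochner_Integration.integral_cong refl) (auto simp: indicator_def)
    have "(LINT x|lebesgue. b x * cutoff_div N a r x)
        = (LINT x|lebesgue. (\<Sum>j\<in>UNIV. b x * partial_deriv j (\<phi> j) x))"
      unfolding \<phi>_def[abs_def] sum_distrib_left[symmetric] sum_partial_deriv_cutoff_field ..
    also have "\<dots> = (\<Sum>j\<in>UNIV. LINT x|lebesgue. b x * partial_deriv j (\<phi> j) x)"
      by (rule Bochner_Integration.integral_sum) (rule intj)
    also have "\<dots> = (\<Sum>j\<in>UNIV. LINT x:\<Omega>|lebesgue. B x $ i * partial_deriv j (\<phi> j) x)"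
      by (intro sum.cong refl, subst restrict)
        (auto simp: off b_def set_lebesgue_integral_def mult.assoc)
    also have "\<dots> = (\<Sum>j\<in>UNIV. - (LINT x:\<Omega>|lebesgue. G x $ i $ j * \<phi> j x))"
      using weak test unfolding has_weak_gradient_def by simp
    also have "\<dots> = - (\<Sum>j\<in>UNIV. LINT x:cball a R|lebesgue. G x $ i $ j * \<phi> j x)"
      unfolding sum_negf by (subst restrict) (auto simp: off)
    finally show ?thesis by (simp add: \<phi>_def)
  qed
  moreover have "(LINT x:cball a R|lebesgue. B x $ i * (cutoff N a r x / r ^ 3)) =
      (LINT x|lebesgue. b x * (cutoff N a r x / r ^ 3))" for r
    by (simp add: set_lebesgue_integral_def b_def mult.assoc)
  ultimately show ?thesis by (simp only:)
qed

section \<open>Oscillation of ball averages\<close>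

text \<open>The Cauchy-Schwarz bound for the integral of \<open>|G|\<close>, obtained by integrating
\<open>|G| \<le> \<tau> / 2 + |G|\<^sup>2 / (2 \<tau>)\<close>. The parameter \<open>\<tau> = r\<^bsup>(\<beta> - 3)/2\<^esup>\<close> gives both terms the same power of
\<open>r\<close>.\<close>

lemma integral_norm_le_of_square_growth:
  fixes G :: "real^3 \<Rightarrow> 'b::euclidean_space"
  assumes G: "L2_loc \<Omega> G" and R: "cball a R \<subseteq> \<Omega>" and r: "0 < r" "r \<le> R"
    and growth: "(LINT x:ball a r|lebesgue. (norm (G x))\<^sup>2) \<le> c * r powr \<beta>"
  shows "(LINT x:ball a r|lebesgue. norm (G x)) \<le> (4 / 3 * pi + c) / 2 * r powr ((\<beta> + 3) / 2)"
proof -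
  define \<tau> where "\<tau> = r powr ((\<beta> - 3) / 2)"
  have "\<tau> > 0" using r by (simp add: \<tau>_def)
  have sub: "ball a r \<subseteq> cball a R" using r by auto
  have intG: "set_integrable lebesgue (ball a r) (\<lambda>x. norm (G x))"
    using set_integrable_subset[OF set_integrable_norm[OF L2_loc_integrable[OF G compact_cball R]] _ sub]
    by simp
  have intG2: "set_integrable lebesgue (ball a r) (\<lambda>x. (norm (G x))\<^sup>2)"
    using set_integrable_subset[OF L2_loc_integrable_square[OF G compact_cball R] _ sub] by simp
  have int1: "set_integrable lebesgue (ball a r) (\<lambda>x. \<tau> / 2)"
    using lmeasurable_ball[of a r]
    by (auto simp: set_integrable_def fmeasurable_def intro!: integrable_real_indicator)
  have intS: "set_integrable lebesgue (ball a r) (\<lambda>x. (1 / (2 * \<tau>)) * (norm (G x))\<^sup>2)"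
    using intG2 by (rule set_integrable_mult_right)
  have "(LINT x:ball a r|lebesgue. norm (G x))
      \<le> (LINT x:ball a r|lebesgue. \<tau> / 2 + (1 / (2 * \<tau>)) * (norm (G x))\<^sup>2)"
  proof (rule set_integral_mono[OF intG set_integral_add(1)[OF int1 intS]])
    fix x
    have "0 \<le> (norm (G x) - \<tau>)\<^sup>2" by simp
    then show "norm (G x) \<le> \<tau> / 2 + (1 / (2 * \<tau>)) * (norm (G x))\<^sup>2"
      using \<open>\<tau> > 0\<close> by (simp add: field_simps power2_eq_square)
  qed
  also have "\<dots> = (LINT x:ball a r|lebesgue. \<tau> / 2) + (1 / (2 * \<tau>)) * (LINT x:ball a r|lebesgue. (norm (G x))\<^sup>2)"
    by (subst set_integral_add(2)[OF int1 intS]) simp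
  also have "(LINT x:ball a r|lebesgue. \<tau> / 2) = \<tau> / 2 * (4 / 3 * pi * r ^ 3)"
    using r by (simp add: set_lebesgue_integral_def content_ball unit_ball_vol_3)
  also have "\<tau> / 2 * (4 / 3 * pi * r ^ 3) + (1 / (2 * \<tau>)) * (LINT x:ball a r|lebesgue. (norm (G x))\<^sup>2)
      \<le> \<tau> / 2 * (4 / 3 * pi * r ^ 3) + (1 / (2 * \<tau>)) * (c * r powr \<beta>)"
    using growth \<open>\<tau> > 0\<close> by (intro add_left_mono mult_left_mono) auto
  also have "\<dots> = (4 / 3 * pi / 2) * (\<tau> * r powr 3) + c / 2 * (r powr \<beta> / \<tau>)"
    using \<open>\<tau> > 0\<close> r by (simp add: field_simps)
  also have "\<tau> * r powr 3 = r powr ((\<beta> + 3) / 2)"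
    unfolding \<tau>_def powr_add[symmetric] by (simp add: field_simps)
  also have "r powr \<beta> / \<tau> = r powr ((\<beta> + 3) / 2)"
    unfolding \<tau>_def powr_diff[symmetric] by (simp add: field_simps)
  finally show ?thesis by (simp add: field_simps)
qed

text \<open>Summing over \<open>j\<close> before estimating gives \<open>G\<^sub>i \<bullet> (x - a)\<close>, so a single factor \<open>r\<close> appears and the bound is
independent of \<open>N\<close>.\<close>

lemma cutoff_flux_bound:
  fixes G :: "real^3 \<Rightarrow> real^3^3"
  assumes G: "L2_loc \<Omega> G" and R: "cball a R \<subseteq> \<Omega>" and r: "0 < r" "r < R" and N: "0 \<le> N"
  shows "\<bar>\<Sum>j\<in>UNIV. LINT x:cball a R|lebesgue. G x $ i $ j * ((x $ j - a $ j) * cutoff N a r x)\<bar>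
    \<le> r * (LINT x:ball a r|lebesgue. norm (G x))"
proof -
  let ?K = "cball a R"
  define f where "f j x = indicator ?K x * (G x $ i $ j * ((x $ j - a $ j) * cutoff N a r x))" for j x
  have GK: "integrable lebesgue (\<lambda>x. indicator ?K x *\<^sub>R G x)"
    using L2_loc_integrable[OF G compact_cball R] by (simp add: set_integrable_def)
  have coord: "\<bar>(x $ j - a $ j) * cutoff N a r x\<bar> \<le> r" for j x
  proof (cases "x \<in> ball a r")
    case True
    have "\<bar>x $ j - a $ j\<bar> \<le> r"
      using component_le_norm_cart[of "x - a" j] True by (simp add: dist_norm norm_minus_commute)
    then have "\<bar>x $ j - a $ j\<bar> * \<bar>cutoff N a r x\<bar> \<le> r * 1"
      using cutoff_bounds[of N a r x] r by (intro mult_mono) auto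
    then show ?thesis by (simp add: abs_mult)
  qed (use r N in \<open>simp add: cutoff_eq_0\<close>)
  have intf: "integrable lebesgue (f j)" for j
  proof -
    have "integrable lebesgue (\<lambda>x. (indicator ?K x *\<^sub>R G x) $ i $ j)"
      by (intro integrable_bounded_linear[OF bounded_linear_vec_nth] GK)
    then have "integrable lebesgue (\<lambda>x. (indicator ?K x *\<^sub>R G x) $ i $ j * ((x $ j - a $ j) * cutoff N a r x))"
      by (rule integrable_mult_continuous[where M = r])
        (auto intro!: continuous_intros continuous_on_cutoff coord)
    then show ?thesis by (simp add: f_def[abs_def] mult.assoc)
  qed
  have intn: "integrable lebesgue (\<lambda>x. r * (indicator (ball a r) x *\<^sub>R norm (G x)))"
  proof -
    have "ball a r \<subseteq> ?K" using r by auto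
    from set_integrable_subset[OF set_integrable_norm[OF L2_loc_integrable[OF G compact_cball R]] _ this]
    show ?thesis by (simp add: set_integrable_def)
  qed
  have "(\<Sum>j\<in>UNIV. LINT x:?K|lebesgue. G x $ i $ j * ((x $ j - a $ j) * cutoff N a r x))
      = (\<Sum>j\<in>UNIV. LINT x|lebesgue. f j x)"
    by (simp add: f_def set_lebesgue_integral_def)
  also have "\<dots> = (LINT x|lebesgue. (\<Sum>j\<in>UNIV. f j x))"
    by (rule Bochner_Integration.integral_sum[symmetric]) (rule intf)
  also have "\<bar>\<dots>\<bar> \<le> (LINT x|lebesgue. \<bar>\<Sum>j\<in>UNIV. f j x\<bar>)"
    by (rule integral_abs_bound)
  also have "\<dots> \<le> (LINT x|lebesgue. r * (indicator (ball a r) x *\<^sub>R norm (G x)))"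
  proof (rule integral_mono[OF _ intn])
    show "integrable lebesgue (\<lambda>x. \<bar>\<Sum>j\<in>UNIV. f j x\<bar>)"
      by (intro integrable_abs Bochner_Integration.integrable_sum intf)
    fix x
    show "\<bar>\<Sum>j\<in>UNIV. f j x\<bar> \<le> r * (indicator (ball a r) x *\<^sub>R norm (G x))"
    proof (cases "x \<in> ball a r")
      case True
      then have K: "x \<in> ?K" and d: "norm (x - a) \<le> r"
        using r by (auto simp: dist_norm norm_minus_commute)
      have "(\<Sum>j\<in>UNIV. f j x) = (G x $ i \<bullet> (x - a)) * cutoff N a r x"
        using K by (simp add: f_def inner_vec_def sum_distrib_right mult.assoc)
      also have "\<bar>\<dots>\<bar> \<le> \<bar>G x $ i \<bullet> (x - a)\<bar> * 1"
        unfolding abs_mult using cutoff_bounds[of N a r x] by (intro mult_left_mono) auto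
      also have "\<dots> \<le> norm (G x $ i) * norm (x - a)"
        using Cauchy_Schwarz_ineq2[of "G x $ i" "x - a"] by simp
      also have "\<dots> \<le> norm (G x) * r"
        using d r by (intro mult_mono) (auto intro: Finite_Cartesian_Product.norm_nth_le)
      finally show ?thesis using True by (simp add: mult.commute)
    next
      case False
      then show ?thesis using cutoff_eq_0[OF N r(1) False] by (simp add: f_def)
    qed
  qed
  also have "\<dots> = r * (LINT x:ball a r|lebesgue. norm (G x))"
    by (simp add: set_lebesgue_integral_def)
  finally show ?thesis .
qed

lemma cutoff_average_tendsto:
  fixes B :: "real^3 \<Rightarrow> real^3"
  assumes B: "L2_loc \<Omega> B" and R: "cball a R \<subseteq> \<Omega>" and r: "0 < r" "r \<le> R"
  shows "(\<lambda>n. LINT x:cball a R|lebesgue. B x $ i * (cutoff (real n) a r x / r ^ 3))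
    \<longlonglongrightarrow> (LINT x:ball a r|lebesgue. B x) $ i / r ^ 3"
proof -
  define b where "b x = indicator (cball a R) x * (B x $ i)" for x
  have b: "integrable lebesgue b"
    using integrable_bounded_linear[OF bounded_linear_vec_nth
        L2_loc_integrable[OF B compact_cball R, unfolded set_integrable_def], of i]
    by (simp add: b_def[abs_def])
  have "(\<lambda>n. LINT x|lebesgue. b x * cutoff (real n) a r x)
      \<longlonglongrightarrow> (LINT x|lebesgue. b x * indicator (ball a r) x)"
  proof (rule integral_dominated_convergence[where w = "\<lambda>x. \<bar>b x\<bar>"])
    show "(\<lambda>x. b x * cutoff (real n) a r x) \<in> borel_measurable lebesgue" for n
      by (rule borel_measurable_integrable[OF integrable_mult_continuous[OF b continuous_on_cutoff abs_cutoff_le]])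
    show "AE x in lebesgue. (\<lambda>n. b x * cutoff (real n) a r x) \<longlonglongrightarrow> b x * indicator (ball a r) x"
      by (intro AE_I2 tendsto_mult_left cutoff_tendsto_indicator r(1))
    show "AE x in lebesgue. norm (b x * cutoff (real n) a r x) \<le> \<bar>b x\<bar>" for n
      by (intro AE_I2) (auto simp: abs_mult intro!: mult_left_le abs_cutoff_le)
  qed (use b in \<open>auto intro!: borel_measurable_times borel_measurable_indicator\<close>)
  also have "(LINT x|lebesgue. b x * indicator (ball a r) x) = (LINT x:ball a r|lebesgue. B x $ i)"
    unfolding set_lebesgue_integral_def
    using r by (intro Bochner_Integration.integral_cong refl) (auto simp: b_def indicator_def)
  also have "\<dots> = (LINT x:ball a r|lebesgue. B x) $ i"
  proof (rule integral_indicator_component[symmetric])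
    show "set_integrable lebesgue (ball a r) B"
      by (rule set_integrable_subset[OF L2_loc_integrable[OF B compact_cball R]]) (use r in auto)
  qed
  finally have "(\<lambda>n. (LINT x|lebesgue. b x * cutoff (real n) a r x) / r ^ 3)
      \<longlonglongrightarrow> (LINT x:ball a r|lebesgue. B x) $ i / r ^ 3"
    by (intro tendsto_divide tendsto_const) (use r in auto)
  then show ?thesis by (simp add: b_def set_lebesgue_integral_def mult.assoc)
qed

text \<open>The bound \<open>|m'(s)| \<le> C s\<^bsup>\<alpha> - 1\<^esup>\<close>, with \<open>\<alpha> = (\<beta> - 1) / 2 > 0\<close>, says that adding or subtracting
\<open>C s\<^sup>\<alpha> / \<alpha>\<close> makes \<open>m\<close> monotone. This controls the smooth averages uniformly in \<open>N\<close>, hence also their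
limits.\<close>

lemma ball_integral_oscillation:
  fixes B :: "real^3 \<Rightarrow> real^3"
  assumes B: "L2_loc \<Omega> B" and G: "L2_loc \<Omega> G" and weak: "has_weak_gradient \<Omega> B G"
    and R: "cball a R \<subseteq> \<Omega>" and \<beta>: "\<beta> > 1" and c: "0 \<le> c"
    and growth: "\<And>r. 0 < r \<Longrightarrow> r < R \<Longrightarrow> (LINT x:ball a r|lebesgue. (norm (G x))\<^sup>2) \<le> c * r powr \<beta>"
    and rt: "0 < r" "r \<le> t" "t < R"
  shows "\<bar>(LINT x:ball a t|lebesgue. B x) $ i / t ^ 3 - (LINT x:ball a r|lebesgue. B x) $ i / r ^ 3\<bar>
    \<le> (4 / 3 * pi + c) / (\<beta> - 1) * t powr ((\<beta> - 1) / 2)"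
proof -
  define \<alpha> where "\<alpha> = (\<beta> - 1) / 2"
  define C where "C = (4 / 3 * pi + c) / 2"
  have \<alpha>: "\<alpha> > 0" using \<beta> by (simp add: \<alpha>_def)
  have C: "C \<ge> 0" using c pi_ge_zero by (simp add: C_def)
  define m where "m n r = (LINT x:cball a R|lebesgue. B x $ i * (cutoff (real n) a r x / r ^ 3))" for n r
  have der: "\<exists>D. (m n has_real_derivative D) (at s) \<and> \<bar>D\<bar> \<le> C * s powr (\<alpha> - 1)"
    if s: "0 < s" "s < R" for n s
  proof -
    let ?S = "\<Sum>j\<in>UNIV. LINT x:cball a R|lebesgue. G x $ i $ j * ((x $ j - a $ j) * cutoff (real n) a s x)"
    have "\<bar>?S\<bar> \<le> s * (LINT x:ball a s|lebesgue. norm (G x))"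
      by (rule cutoff_flux_bound[OF G R s]) simp
    also have "\<dots> \<le> s * (C * s powr ((\<beta> + 3) / 2))"
      unfolding C_def using s
      by (intro mult_left_mono integral_norm_le_of_square_growth[OF G R _ _ growth]) auto
    also have "\<dots> = C * s powr (\<alpha> - 1) * s ^ 4"
    proof -
      have "s * s powr ((\<beta> + 3) / 2) = s powr (1 + (\<beta> + 3) / 2)" using s by (simp add: powr_add)
      also have "1 + (\<beta> + 3) / 2 = (\<alpha> - 1) + 4" by (simp add: \<alpha>_def field_simps)
      also have "s powr \<dots> = s powr (\<alpha> - 1) * s ^ 4" unfolding powr_add using s by simp
      finally show ?thesis by simp
    qed
    finally have "\<bar>?S / s ^ 4\<bar> \<le> C * s powr (\<alpha> - 1)"
      using s by (simp add: abs_divide divide_le_eq)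
    moreover have "(m n has_real_derivative ?S / s ^ 4) (at s)"
      unfolding m_def[abs_def] by (rule cutoff_average_derivative[OF B G weak R s]) simp
    ultimately show ?thesis by blast
  qed
  have p: "((\<lambda>s. C / \<alpha> * s powr \<alpha>) has_real_derivative C * s powr (\<alpha> - 1)) (at s)" if "s > 0" for s
    using that \<alpha> by (auto intro!: derivative_eq_intros)
  have osc: "\<bar>m n t - m n r\<bar> \<le> C / \<alpha> * t powr \<alpha>" for n
  proof -
    have "m n r + C / \<alpha> * r powr \<alpha> \<le> m n t + C / \<alpha> * t powr \<alpha>"
    proof (rule DERIV_nonneg_imp_nondecreasing[OF rt(2)])
      fix s assume "r \<le> s" "s \<le> t"
      then have s: "0 < s" "s < R" using rt by auto
      from der[OF this] obtain D where D: "(m n has_real_derivative D) (at s)" "\<bar>D\<bar> \<le> C * s powr (\<alpha> - 1)"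
        by blast
      from DERIV_add[OF D(1) p[OF s(1)]] D(2)
      show "\<exists>y. ((\<lambda>s. m n s + C / \<alpha> * s powr \<alpha>) has_real_derivative y) (at s) \<and> 0 \<le> y"
        by (intro exI conjI) auto
    qed
    moreover have "m n t - C / \<alpha> * t powr \<alpha> \<le> m n r - C / \<alpha> * r powr \<alpha>"
    proof (rule DERIV_nonpos_imp_nonincreasing[OF rt(2)])
      fix s assume "r \<le> s" "s \<le> t"
      then have s: "0 < s" "s < R" using rt by auto
      from der[OF this] obtain D where D: "(m n has_real_derivative D) (at s)" "\<bar>D\<bar> \<le> C * s powr (\<alpha> - 1)"
        by blast
      from DERIV_diff[OF D(1) p[OF s(1)]] D(2)
      show "\<exists>y. ((\<lambda>s. m n s - C / \<alpha> * s powr \<alpha>) has_real_derivative y) (at s) \<and> y \<le> 0"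
        by (intro exI conjI) auto
    qed
    moreover have "0 \<le> C / \<alpha> * r powr \<alpha>" using C \<alpha> by simp
    ultimately show ?thesis by linarith
  qed
  have "(\<lambda>n. \<bar>m n t - m n r\<bar>) \<longlonglongrightarrow>
      \<bar>(LINT x:ball a t|lebesgue. B x) $ i / t ^ 3 - (LINT x:ball a r|lebesgue. B x) $ i / r ^ 3\<bar>"
    unfolding m_def using rt by (intro tendsto_intros cutoff_average_tendsto[OF B R]) auto
  from LIMSEQ_le_const2[OF this] osc
  have "\<bar>(LINT x:ball a t|lebesgue. B x) $ i / t ^ 3 - (LINT x:ball a r|lebesgue. B x) $ i / r ^ 3\<bar>
      \<le> C / \<alpha> * t powr \<alpha>" by blast
  also have "C / \<alpha> = (4 / 3 * pi + c) / (\<beta> - 1)" using \<beta> by (simp add: C_def \<alpha>_def field_simps)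
  finally show ?thesis by (simp add: \<alpha>_def)
qed

section \<open>The singular set\<close>

text \<open>A ball is connected, so it cannot leave \<open>\<Omega>\<close> without meeting the boundary.\<close>

lemma cball_subset_of_esetdist_frontier:
  fixes x :: "'a::real_normed_vector"
  assumes "x \<in> \<Omega>" "0 < r" "ereal r < esetdist {x} (frontier \<Omega>)"
  shows "cball x r \<subseteq> \<Omega>"
proof (rule ccontr)
  assume "\<not> cball x r \<subseteq> \<Omega>"
  then have "cball x r \<inter> frontier \<Omega> \<noteq> {}"
  proof (intro connected_Int_frontier connected_cball)
    have "x \<in> cball x r \<inter> \<Omega>" using assms(1,2) by simp
    then show "cball x r \<inter> \<Omega> \<noteq> {}" by blast
  qed auto
  then obtain y where y: "y \<in> frontier \<Omega>" "dist x y \<le> r" by auto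
  have "esetdist {x} (frontier \<Omega>) \<le> ereal (dist x y)"
    unfolding esetdist_def by simp (rule INF_lower[OF y(1)])
  with y(2) assms(3) show False by (meson ereal_less_eq(3) leD order_trans)
qed

text \<open>Radii up to \<open>t\<close> are compared with \<open>t\<close> through the oscillation bound. The remaining radii are bounded below,
and there integrability of \<open>B\<close> on one compact ball suffices.\<close>

lemma ball_average_bounded:
  fixes B :: "real^3 \<Rightarrow> real^3"
  assumes B: "L2_loc \<Omega> B" and G: "L2_loc \<Omega> G" and weak: "has_weak_gradient \<Omega> B G"
    and R: "cball a R \<subseteq> \<Omega>" "0 < R" and \<beta>: "\<beta> > 1" and c: "0 \<le> c" and \<delta>: "0 < \<delta>"
    and growth: "\<And>r. 0 < r \<Longrightarrow> r < \<delta> \<Longrightarrow> (LINT x:ball a r|lebesgue. (norm (G x))\<^sup>2) \<le> c * r powr \<beta>"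
  shows "\<exists>M. \<forall>r. 0 < r \<and> r < R \<longrightarrow> norm (ball_average B a r) \<le> M"
proof -
  define R' where "R' = min R \<delta>"
  define t where "t = R' / 2"
  have t: "0 < t" "t < R'" "t < R" "cball a R' \<subseteq> \<Omega>"
    using R \<delta> by (auto simp: t_def R'_def)
  define C where "C = (4 / 3 * pi + c) / (\<beta> - 1) * t powr ((\<beta> - 1) / 2)"
  define I where "I r = (LINT x:ball a r|lebesgue. B x)" for r
  define J where "J = (LINT x:cball a R|lebesgue. norm (B x))"
  define M where "M = (\<Sum>i\<in>UNIV. \<bar>I t $ i / t ^ 3\<bar> + C) + J / t ^ 3"
  have intJ: "set_integrable lebesgue (cball a R) (\<lambda>x. norm (B x))"
    by (intro set_integrable_norm L2_loc_integrable[OF B compact_cball R(1)])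
  have J: "norm (I r) \<le> J" if "r < R" for r
  proof -
    have sub: "ball a r \<subseteq> cball a R" using that by auto
    have "norm (I r) \<le> (LINT x:ball a r|lebesgue. norm (B x))"
      unfolding I_def
      by (intro set_integral_norm_bound set_integrable_subset[OF L2_loc_integrable[OF B compact_cball R(1)]])
        (use sub in auto)
    also have "\<dots> \<le> J"
      unfolding J_def set_lebesgue_integral_def
    proof (rule integral_mono)
      show "integrable lebesgue (\<lambda>x. indicator (ball a r) x *\<^sub>R norm (B x))"
        using set_integrable_subset[OF intJ _ sub] by (simp add: set_integrable_def)
      show "integrable lebesgue (\<lambda>x. indicator (cball a R) x *\<^sub>R norm (B x))"
        using intJ by (simp add: set_integrable_def)
    qed (use sub in \<open>auto simp: indicator_def\<close>)
    finally show ?thesis .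
  qed
  have C0: "C \<ge> 0" using c \<beta> pi_ge_zero by (auto simp: C_def intro!: mult_nonneg_nonneg divide_nonneg_pos)
  have J0: "J \<ge> 0" using J[of t] t norm_ge_zero order_trans by blast
  have main: "norm (I r) / r ^ 3 \<le> M" if r: "0 < r" "r < R" for r
  proof (cases "r \<le> t")
    case True
    have "\<bar>I r $ i / r ^ 3\<bar> \<le> \<bar>I t $ i / t ^ 3\<bar> + C" for i
      using ball_integral_oscillation[OF B G weak t(4) \<beta> c growth r(1) True t(2), of i]
      unfolding I_def C_def R'_def by linarith
    then have "(\<Sum>i\<in>UNIV. \<bar>I r $ i / r ^ 3\<bar>) \<le> (\<Sum>i\<in>UNIV. \<bar>I t $ i / t ^ 3\<bar> + C)"
      by (rule sum_mono)
    moreover have "norm (I r) / r ^ 3 \<le> (\<Sum>i\<in>UNIV. \<bar>I r $ i / r ^ 3\<bar>)"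
      using divide_right_mono[OF norm_le_l1_cart[of "I r"], of "r ^ 3"] r
      by (simp add: abs_divide sum_divide_distrib)
    ultimately show ?thesis using J0 t unfolding M_def by (smt (verit) divide_nonneg_pos zero_less_power)
  next
    case False
    have "norm (I r) / r ^ 3 \<le> J / t ^ 3"
      using False t r J[OF r(2)] J0 by (intro frac_le power_mono) auto
    moreover have "0 \<le> (\<Sum>i\<in>UNIV. \<bar>I t $ i / t ^ 3\<bar> + C)"
      using C0 by (intro sum_nonneg) auto
    ultimately show ?thesis unfolding M_def by linarith
  qed
  have "norm (ball_average B a r) \<le> M / (4 / 3 * pi)" if r: "0 < r" "r < R" for r
  proof -
    have "norm (ball_average B a r) = norm (I r) / r ^ 3 / (4 / 3 * pi)"
      using r by (simp add: ball_average_def I_def content_ball unit_ball_vol_3 field_simps power3_eq_cube)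
    also have "\<dots> \<le> M / (4 / 3 * pi)"
      by (intro divide_right_mono main r) simp
    finally show ?thesis .
  qed
  then show ?thesis by blast
qed

lemma weak_gradient_W12_loc:
  assumes "W12_loc \<Omega> B"
  shows "L2_loc \<Omega> (weak_gradient \<Omega> B)" "has_weak_gradient \<Omega> B (weak_gradient \<Omega> B)"
  using someI_ex[of "\<lambda>G. L2_loc \<Omega> G \<and> has_weak_gradient \<Omega> B G"] assms
  by (auto simp: W12_loc_def weak_gradient_def)

lemma regular_of_gradient_growth:
  fixes B :: "real^3 \<Rightarrow> real^3"
  assumes W: "W12_loc \<Omega> B" and a: "a \<in> \<Omega>" and \<beta>: "\<beta> > 1" and c: "0 \<le> c" and \<delta>: "0 < \<delta>"
    and growth: "\<And>r. 0 < r \<Longrightarrow> r < \<delta> \<Longrightarrow>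
      (LINT x:ball a r|lebesgue. (norm (weak_gradient \<Omega> B x))\<^sup>2) \<le> c * r powr \<beta>"
  shows "a \<notin> singular_set \<Omega> B"
proof -
  let ?G = "weak_gradient \<Omega> B"
  let ?E = "\<lambda>r. LINT x:ball a r|lebesgue. (norm (?G x))\<^sup>2"
  have B: "L2_loc \<Omega> B" using W by (simp add: W12_loc_def)
  have G: "L2_loc \<Omega> ?G" "has_weak_gradient \<Omega> B ?G"
    using weak_gradient_W12_loc[OF W] by auto
  have "((\<lambda>r. c * r powr (\<beta> - 1)) \<longlongrightarrow> c * 0) (at_right 0)"
    using \<beta> by (intro tendsto_mult_left tendsto_zero_powrI[where b = "\<beta> - 1"])
      (auto intro!: tendsto_ident_at simp: eventually_at_right_field exI[of _ 1])
  then have "((\<lambda>r. ereal (c * r powr (\<beta> - 1))) \<longlongrightarrow> 0) (at_right 0)"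
    by (simp add: zero_ereal_def)
  then have "Liminf (at_right 0) (\<lambda>r. ereal (c * r powr (\<beta> - 1))) = 0"
    by (intro lim_imp_Liminf) auto
  moreover have "Liminf (at_right 0) (\<lambda>r. ereal (1 / r * ?E r)) \<le> Liminf (at_right 0) (\<lambda>r. ereal (c * r powr (\<beta> - 1)))"
  proof (rule Liminf_mono)
    have "1 / r * ?E r \<le> c * r powr (\<beta> - 1)" if "0 < r" "r < \<delta>" for r
      using growth[OF that] that by (simp add: powr_diff field_simps)
    then show "\<forall>\<^sub>F r in at_right 0. ereal (1 / r * ?E r) \<le> ereal (c * r powr (\<beta> - 1))"
      using \<delta> by (auto simp: eventually_at_right_field)
  qed
  moreover have "(SUP r\<in>{0<..<r0}. ereal (norm (ball_average B a r))) \<noteq> \<infinity>"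
    if r0: "0 < r0" "ereal r0 < esetdist {a} (frontier \<Omega>)" for r0
  proof -
    obtain M where M: "\<And>r. 0 < r \<Longrightarrow> r < r0 \<Longrightarrow> norm (ball_average B a r) \<le> M"
      using ball_average_bounded[OF B G cball_subset_of_esetdist_frontier[OF a r0] r0(1) \<beta> c \<delta> growth]
      by blast
    have "(SUP r\<in>{0<..<r0}. ereal (norm (ball_average B a r))) \<le> ereal M"
      by (rule SUP_least) (use M in auto)
    then show ?thesis by auto
  qed
  ultimately show ?thesis unfolding singular_set_def by auto
qed

theorem mainTheorem2:
  fixes \<Omega> :: "(real^3) set" and F B :: "real^3 \<Rightarrow> real^3" and lam :: real
  assumes "open \<Omega>" and "connected \<Omega>" and "\<Omega> \<noteq> {}"
    and "1 < lam" and "lam < 3"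
    and "Morrey2_loc lam \<Omega> F"
    and "W12_loc \<Omega> B"
    and "suitable_weak_solution \<Omega> F B"
  shows "(\<forall>\<beta>>1. hausdorff_measure \<beta> (singular_set \<Omega> B) = 0)
    \<and> hausdorff_dim (singular_set \<Omega> B) \<le> 1"
proof -
  let ?G = "weak_gradient \<Omega> B"
  have G: "L2_loc \<Omega> ?G"
    using \<open>W12_loc \<Omega> B\<close> by (rule weak_gradient_W12_loc)
  obtain K where K: "\<And>n. compact (K n)" "\<And>n. K n \<subseteq> \<Omega>" "\<And>n. K n \<subseteq> interior (K (Suc n))" "\<Union>(range K) = \<Omega>"
    using open_Union_compact_subsets[OF \<open>open \<Omega>\<close>] by metis
  have null: "hausdorff_measure \<beta> (singular_set \<Omega> B) = 0" if \<beta>: "\<beta> > 1" for \<beta>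
  proof (rule hausdorff_measure_null_mono)
    show "hausdorff_measure \<beta> (\<Union>n. singular_set \<Omega> B \<inter> K n) = 0"
    proof (intro hausdorff_measure_null_UN hausdorff_null_of_large_density)
      fix n
      show "set_integrable lebesgue (interior (K (Suc n))) (\<lambda>x. (norm (?G x))\<^sup>2)"
        by (rule set_integrable_subset[OF L2_loc_integrable_square[OF G K(1,2)]])
          (use interior_subset in auto)
      show "singular_set \<Omega> B \<inter> K n \<subseteq> interior (K (Suc n))" using K(3) by blast
      fix a and c \<delta> :: real
      assume a: "a \<in> singular_set \<Omega> B \<inter> K n" and "0 < c" "0 < \<delta>"
      show "\<exists>r. 0 < r \<and> r < \<delta> \<and> c * r powr \<beta> \<le> (LINT x:ball a r|lebesgue. (norm (?G x))\<^sup>2)"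
        using regular_of_gradient_growth[OF \<open>W12_loc \<Omega> B\<close> _ \<beta>, of a c \<delta>] a K(2)[of n] \<open>0 < c\<close> \<open>0 < \<delta>\<close>
        by (meson IntD1 IntD2 less_imp_le linear subsetD)
    qed (use \<beta> in auto)
    show "singular_set \<Omega> B \<subseteq> (\<Union>n. singular_set \<Omega> B \<inter> K n)"
      using K(4) by (auto simp: singular_set_def)
  qed
  have "hausdorff_dim (singular_set \<Omega> B) \<le> 1"
  proof (rule ereal_le_epsilon2)
    fix e :: real assume "e > 0"
    show "hausdorff_dim (singular_set \<Omega> B) \<le> 1 + ereal e"
      unfolding hausdorff_dim_def one_ereal_def plus_ereal.simps
      by (rule INF_lower) (use null[of "1 + e"] \<open>e > 0\<close> in auto)
  qed
  with null show ?thesis by blast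
qed

end
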